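(* Let $m,n\ge1$ be integers, let $P:[0,1]\to\mathbb{R}$ be continuous and nonnegative almost everywhere, let $\omega$ be a strictly increasing modulus of continuity, and let a set $\overline{x}=\{x_1,\dots,x_n\}\subset[0,1]$ of $n$ distinct points and a collection $\overline{\varepsilon}=\{\varepsilon_1,\dots,\varepsilon_n\}$ of nonnegative numbers be given. Put $$f_{\omega,\overline{x},\overline{\varepsilon}}(x)=\min_{k=1,\dots,n}\{\varepsilon_k+\omega(|x-x_k|)\},\quad x\in[0,1],$$ $$\Pi_k=\bigl\{x\in[0,1]:\ f_{\omega,\overline{x},\overline{\varepsilon}}(x)=\varepsilon_k+\omega(|x-x_k|)\bigr\},\quad k=1,\dots,n,$$ and let $k_1,\dots,k_\nu$ be the numbers $k\in\{1,\dots,n\}$ for which $\Pi_k\ne\emptyset$. Then $$R(H^\omega([0,1],K(\mathbb{R}^m)),\overline{x},\overline{\varepsilon})=R(H^\omega([0,1],K(\mathbb{R}^m)),\Phi^*,\overline{x},\overline{\varepsilon})=\int_0^1P(x)f_{\omega,\overline{x},\overline{\varepsilon}}(x)\,dx,$$ where $$\Phi^*(A_1,\dots,A_n)=\mathrm{co}\Bigl(\sum_{j=1}^{\nu}\int_{\Pi_{k_j}}P(x)\,dx\cdot A_{k_j}\Bigr).$$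
   Context: $K(\mathbb{R}^m)$ is the set of nonempty compact subsets of $\mathbb{R}^m$. For $A,B\in K(\mathbb{R}^m)$ and $\lambda,\mu\in\mathbb{R}$, $\lambda A+\mu B=\{\lambda a+\mu b:a\in A,\,b\in B\}$ (Minkowski combination); $\mathrm{co}\,A$ is the convex hull of $A$. With $\|\cdot\|$ the Euclidean norm, $d(a,B)=\inf_{b\in B}\|a-b\|$ and $d(A,B)=\sup_{a\in A}d(a,B)$, the Hausdorff metric on $K(\mathbb{R}^m)$ is $\delta(A,B)=\max\{d(A,B),d(B,A)\}$. Riemann–Minkowski integral: for $g:[0,1]\to K(\mathbb{R}^m)$, a partition $0=t_0<t_1<\dots<t_N=1$ and tags $\xi_i\in[t_{i-1},t_i]$, the Riemann–Minkowski sum is $\sum_{i=1}^N(t_i-t_{i-1})g(\xi_i)$. The function $g$ is integrable, with integral $\int_0^1g(x)\,dx=I\in K(\mathbb{R}^m)$, if the Riemann–Minkowski sums converge to $I$ in the metric $\delta$ as the mesh $\max_i(t_i-t_{i-1})$ tends to $0$. Integrals of set-valued functions are understood in this sense; continuous bounded functions are integrable. A modulus of continuity is, as usual, a continuous nondecreasing subadditive function $\omega:[0,\infty)\to[0,\infty)$ with $\omega(0)=0$. $H^\omega([0,1],K(\mathbb{R}^m))$ is the class of functions $f:[0,1]\to K(\mathbb{R}^m)$ such that $\delta(f(x'),f(x''))\le\omega(|x'-x''|)$ for all $x',x''\in[0,1]$. Recovery from information with error: instead of the exact values $f(x_k)$ one is given sets $A_k\in K(\mathbb{R}^m)$ with $\delta(f(x_k),A_k)\le\varepsilon_k$,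 $k=1,\dots,n$. A method of recovery is an arbitrary mapping $\Phi:K(\mathbb{R}^m)^n\to K(\mathbb{R}^m)$. For a class $\mathcal{M}$ of continuous functions $f:[0,1]\to K(\mathbb{R}^m)$, $$R(\mathcal{M},\Phi,\overline{x},\overline{\varepsilon})=\sup_{f\in\mathcal{M}}\ \sup_{\substack{A_k\in K(\mathbb{R}^m),\ \delta(A_k,f(x_k))\le\varepsilon_k,\\ k=1,\dots,n}}\delta\Bigl(\int_0^1P(x)f(x)\,dx,\ \Phi(A_1,\dots,A_n)\Bigr),$$ $$R(\mathcal{M},\overline{x},\overline{\varepsilon})=\inf_{\Phi}R(\mathcal{M},\Phi,\overline{x},\overline{\varepsilon}),$$ the infimum being over all methods $\Phi$.
   Formalization: The claim that Φ* attains the optimal error is proved only when the integral of P over Π_i∩Π_j is 0 for all i≠j; otherwise the weights sum to more than the integral of P and constant functions give Φ* infinite error. The value of the optimal error is proved without this condition. *)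

theory Defs
  imports "HOL-Analysis.Analysis"
begin

text \<open>Sums of sets are Minkowski sums, as provided by \<^theory>\<open>HOL-Library.Set_Algebras\<close>;
  in particular an empty sum of sets is \<open>{0}\<close>.\<close>

definition compacts :: "'a::euclidean_space set set" where
  "compacts = {A. compact A \<and> A \<noteq> {}}"

definition mscale :: "real \<Rightarrow> 'a::real_vector set \<Rightarrow> 'a set" where
  "mscale c A = (\<lambda>a. c *\<^sub>R a) ` A"

definition excess :: "'a::metric_space set \<Rightarrow> 'a set \<Rightarrow> real" where
  "excess A B = (SUP a\<in>A. infdist a B)"

definition hausdorff :: "'a::metric_space set \<Rightarrow> 'a set \<Rightarrow> real" where
  "hausdorff A B = max (excess A B) (excess B A)"

definition tagged_partition01 :: "nat \<Rightarrow> (nat \<Rightarrow> real) \<Rightarrow> (nat \<Rightarrow> real) \<Rightarrow> bool" where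
  "tagged_partition01 N t \<xi> \<longleftrightarrow> N \<ge> 1 \<and> t 0 = 0 \<and> t N = 1 \<and>
     (\<forall>i\<in>{1..N}. t (i - 1) < t i \<and> \<xi> i \<in> {t (i - 1)..t i})"

definition rm_sum :: "(real \<Rightarrow> 'a::euclidean_space set) \<Rightarrow> nat \<Rightarrow> (nat \<Rightarrow> real) \<Rightarrow> (nat \<Rightarrow> real) \<Rightarrow> 'a set" where
  "rm_sum g N t \<xi> = (\<Sum>i=1..N. mscale (t i - t (i - 1)) (g (\<xi> i)))"

definition has_rm_integral :: "(real \<Rightarrow> 'a::euclidean_space set) \<Rightarrow> 'a set \<Rightarrow> bool" where
  "has_rm_integral g I \<longleftrightarrow> I \<in> compacts \<and>
     (\<forall>e>0. \<exists>d>0. \<forall>N t \<xi>. tagged_partition01 N t \<xi> \<and> (\<forall>i\<in>{1..N}. t i - t (i - 1) < d)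
        \<longrightarrow> hausdorff (rm_sum g N t \<xi>) I < e)"

definition rm_integral :: "(real \<Rightarrow> 'a::euclidean_space set) \<Rightarrow> 'a set" where
  "rm_integral g = (THE I. has_rm_integral g I)"

definition modulus_of_continuity :: "(real \<Rightarrow> real) \<Rightarrow> bool" where
  "modulus_of_continuity \<omega> \<longleftrightarrow> continuous_on {0..} \<omega> \<and> mono_on {0..} \<omega> \<and>
     (\<forall>t\<ge>0. 0 \<le> \<omega> t) \<and> (\<forall>s\<ge>0. \<forall>t\<ge>0. \<omega> (s + t) \<le> \<omega> s + \<omega> t) \<and> \<omega> 0 = 0"

text \<open>Functions on \<open>[0,1]\<close> are represented by total functions on the reals whose values outside
  \<open>[0,1]\<close> are never used.\<close>

definition H_class :: "(real \<Rightarrow> real) \<Rightarrow> (real \<Rightarrow> 'a::euclidean_space set) set" where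
  "H_class \<omega> = {f. (\<forall>x\<in>{0..1}. f x \<in> compacts) \<and>
     (\<forall>x'\<in>{0..1}. \<forall>x''\<in>{0..1}. hausdorff (f x') (f x'') \<le> \<omega> \<bar>x' - x''\<bar>)}"

text \<open>An \<open>n\<close>-tuple of sets is an extensional function on \<open>{1..n}\<close>.\<close>

definition methods :: "nat \<Rightarrow> ((nat \<Rightarrow> 'a::euclidean_space set) \<Rightarrow> 'a set) set" where
  "methods n = ({1..n} \<rightarrow>\<^sub>E compacts) \<rightarrow> compacts"

definition admissible_info ::
  "nat \<Rightarrow> (nat \<Rightarrow> real) \<Rightarrow> (nat \<Rightarrow> real) \<Rightarrow> (real \<Rightarrow> 'a::euclidean_space set) \<Rightarrow> (nat \<Rightarrow> 'a set) set" where
  "admissible_info n xs \<epsilon> f =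
     {A \<in> {1..n} \<rightarrow>\<^sub>E compacts. \<forall>k\<in>{1..n}. hausdorff (A k) (f (xs k)) \<le> \<epsilon> k}"

text \<open>The errors are extended reals because a method may have infinite error on the class.\<close>

definition method_error ::
  "nat \<Rightarrow> (real \<Rightarrow> real) \<Rightarrow> (real \<Rightarrow> 'a::euclidean_space set) set \<Rightarrow>
   ((nat \<Rightarrow> 'a set) \<Rightarrow> 'a set) \<Rightarrow> (nat \<Rightarrow> real) \<Rightarrow> (nat \<Rightarrow> real) \<Rightarrow> ereal" where
  "method_error n P M \<Phi> xs \<epsilon> =
     (SUP f\<in>M. SUP A\<in>admissible_info n xs \<epsilon> f.
        ereal (hausdorff (rm_integral (\<lambda>x. mscale (P x) (f x))) (\<Phi> A)))"

definition optimal_error ::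
  "nat \<Rightarrow> (real \<Rightarrow> real) \<Rightarrow> (real \<Rightarrow> 'a::euclidean_space set) set \<Rightarrow>
   (nat \<Rightarrow> real) \<Rightarrow> (nat \<Rightarrow> real) \<Rightarrow> ereal" where
  "optimal_error n P M xs \<epsilon> = (INF \<Phi>\<in>methods n. method_error n P M \<Phi> xs \<epsilon>)"

definition f_min :: "nat \<Rightarrow> (real \<Rightarrow> real) \<Rightarrow> (nat \<Rightarrow> real) \<Rightarrow> (nat \<Rightarrow> real) \<Rightarrow> real \<Rightarrow> real" where
  "f_min n \<omega> xs \<epsilon> x = Min ((\<lambda>k. \<epsilon> k + \<omega> \<bar>x - xs k\<bar>) ` {1..n})"

definition Pi_set :: "nat \<Rightarrow> (real \<Rightarrow> real) \<Rightarrow> (nat \<Rightarrow> real) \<Rightarrow> (nat \<Rightarrow> real) \<Rightarrow> nat \<Rightarrow> real set" where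
  "Pi_set n \<omega> xs \<epsilon> k = {x\<in>{0..1}. f_min n \<omega> xs \<epsilon> x = \<epsilon> k + \<omega> \<bar>x - xs k\<bar>}"

text \<open>Distinct \<open>Pi_set\<close>s may overlap in a set of positive measure even for strictly increasing
  \<open>\<omega>\<close>: for \<open>\<omega> t = t\<close>, \<open>xs 1 = 0\<close>, \<open>xs 2 = 1/2\<close>, \<open>\<epsilon> 1 = 0\<close>, \<open>\<epsilon> 2 = 1/2\<close> they are \<open>[0,1]\<close>
  and \<open>[1/2,1]\<close>. If \<open>P\<close> has positive mass on the overlap, then the weights in \<open>Phi_star\<close> add up
  to more than the integral of \<open>P\<close>, and constant functions show that the error of \<open>Phi_star\<close> is
  infinite.\<close>

definition Phi_star ::
  "nat \<Rightarrow> (real \<Rightarrow> real) \<Rightarrow> (real \<Rightarrow> real) \<Rightarrow> (nat \<Rightarrow> real) \<Rightarrow> (nat \<Rightarrow> real) \<Rightarrow>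
   (nat \<Rightarrow> 'a::euclidean_space set) \<Rightarrow> 'a set" where
  "Phi_star n P \<omega> xs \<epsilon> A =
     convex hull (\<Sum>k\<in>{k\<in>{1..n}. Pi_set n \<omega> xs \<epsilon> k \<noteq> {}}.
        mscale (integral (Pi_set n \<omega> xs \<epsilon> k) P) (A k))"

lemma compacts_mscale: "A \<in> compacts \<Longrightarrow> mscale c A \<in> compacts"
  by (simp add: compacts_def mscale_def compact_scaling)

lemma compacts_plus: "A \<in> compacts \<Longrightarrow> B \<in> compacts \<Longrightarrow> A + B \<in> compacts"
proof -
  have "A + B = {a + b |a b. a \<in> A \<and> b \<in> B}" by (auto simp: set_plus_def)
  then show "A \<in> compacts \<Longrightarrow> B \<in> compacts \<Longrightarrow> A + B \<in> compacts"
    using compact_sums[of A B] by (auto simp: compacts_def)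
qed

lemma compacts_sum: "(\<And>k. k \<in> K \<Longrightarrow> A k \<in> compacts) \<Longrightarrow> (\<Sum>k\<in>K. A k) \<in> compacts"
proof (induction K rule: infinite_finite_induct)
  case (insert k K)
  then show ?case by (simp add: compacts_plus)
qed (simp_all add: compacts_def)

lemma Phi_star_methods: "Phi_star n P \<omega> xs \<epsilon> \<in> methods n"
proof -
  have "Phi_star n P \<omega> xs \<epsilon> A \<in> compacts" if "A \<in> {1..n} \<rightarrow>\<^sub>E compacts" for A :: "nat \<Rightarrow> 'a set"
  proof -
    have "(\<Sum>k\<in>{k\<in>{1..n}. Pi_set n \<omega> xs \<epsilon> k \<noteq> {}}.
        mscale (integral (Pi_set n \<omega> xs \<epsilon> k) P) (A k)) \<in> compacts"
      using that by (intro compacts_sum compacts_mscale) auto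
    then show ?thesis
      by (simp add: Phi_star_def compacts_def compact_convex_hull)
  qed
  then show ?thesis by (auto simp: methods_def)
qed

end

theory Submission
  imports Defs
begin

text \<open>The proof works with support functions: \<open>supp A u\<close> is the maximum of \<open>u \<bullet> a\<close> over \<open>a \<in>
  A\<close>. Support functions are additive under Minkowski sums, do not see convex hulls, and on
  the unit ball they differ by at most the Hausdorff distance, with equality of the supremum
  for convex sets (\<open>supp_diff_le_hausdorff\<close>, \<open>hausdorff_le_supp\<close>).

  Integration. Every continuous set-valued function \<open>g\<close> is integrable, and its integral is the
  convex compact set whose support function in direction \<open>u\<close> is the integral of \<open>supp (g x)
  u\<close> (\<open>rm_integral_continuous\<close>). Indeed, the support functions of the Riemann--Minkowski
  sums are ordinary Riemann sums, which converge uniformly for \<open>u\<close> in the unit ball. The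
  sums themselves are almost convex by an inequality of Shapley--Folkman type
  (\<open>hausdorff_sum_convex_hull\<close>): if the points of the \<open>i\<close>-th summand have norm at most \<open>D
  i\<close>, then the distance of the sum from its convex hull is at most the square root of the
  sum of the \<open>(2 * D i)\<^sup>2\<close>. Hence the sums form a Cauchy net, and the Hausdorff metric is
  complete (\<open>hausdorff_complete\<close>).

  Upper bound. Choose for each \<open>x\<close> the least index \<open>k\<close> with \<open>x\<close> in the \<open>k\<close>-th set \<open>Pi_set\<close>.
  This gives a measurable partition of \<open>[0,1]\<close> into cells. Combining the \<open>A k\<close> with the
  integrals of \<open>P\<close> over the cells as weights, and taking the convex hull, gives a method
  whose value has in direction \<open>u\<close> the integral of \<open>P x * supp (A k) u\<close> as its support
  function, where \<open>k\<close> is the index of the cell of \<open>x\<close>. On this cell the Hausdorff distance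
  of \<open>f x\<close> and \<open>A k\<close> is at most \<open>\<epsilon> k + \<omega> \<bar>x - xs k\<bar>\<close>, which equals \<open>f_min n \<omega> xs \<epsilon> x\<close>;
  integration gives the bound (\<open>cell_method_error_le\<close>). If the sets \<open>Pi_set\<close> overlap in sets
  of zero mass, then this method coincides with \<open>Phi_star\<close>.

  Lower bound. The function \<open>f_min\<close> itself has modulus of continuity \<open>\<omega>\<close> and is at most \<open>\<epsilon> k\<close>
  at \<open>xs k\<close>. For a unit vector \<open>e\<close>, the two functions whose values are the one-point sets of
  \<open>f_min x *\<^sub>R e\<close> and of its negative therefore belong to the class and admit the same
  information \<open>A k = {0}\<close>, while their integrals are at a distance of twice the integral of
  \<open>P x * f_min x\<close> (\<open>method_error_ge\<close>).\<close>

section \<open>The Hausdorff distance between compact sets\<close>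

lemma compacts_singleton [simp]: "{a} \<in> compacts"
  by (simp add: compacts_def)

lemma compacts_convex_hull: "A \<in> compacts \<Longrightarrow> convex hull A \<in> compacts"
  by (simp add: compacts_def compact_convex_hull)

lemma excess_le_iff:
  assumes "A \<in> compacts" "B \<in> compacts"
  shows "excess A B \<le> r \<longleftrightarrow> (\<forall>a\<in>A. \<exists>b\<in>B. dist a b \<le> r)"
proof -
  have "continuous_on A (\<lambda>a. infdist a B)" by (intro continuous_intros)
  then have "compact ((\<lambda>a. infdist a B) ` A)"
    using assms(1) by (simp add: compacts_def compact_continuous_image)
  then have "bdd_above ((\<lambda>a. infdist a B) ` A)"
    by (intro bounded_imp_bdd_above compact_imp_bounded)
  then have "excess A B \<le> r \<longleftrightarrow> (\<forall>a\<in>A. infdist a B \<le> r)"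
    unfolding excess_def using assms by (simp add: cSUP_le_iff compacts_def)
  moreover have "infdist a B \<le> r \<longleftrightarrow> (\<exists>b\<in>B. dist a b \<le> r)" for a
  proof
    assume r: "infdist a B \<le> r"
    have "closed B" "B \<noteq> {}" using assms by (simp_all add: compacts_def compact_imp_closed)
    from infdist_attains_inf[OF this] r show "\<exists>b\<in>B. dist a b \<le> r" by metis
  next
    show "infdist a B \<le> r" if "\<exists>b\<in>B. dist a b \<le> r"
      using that infdist_le2 by blast
  qed
  ultimately show ?thesis by simp
qed

lemma hausdorff_le_iff:
  assumes "A \<in> compacts" "B \<in> compacts"
  shows "hausdorff A B \<le> r \<longleftrightarrow>
    (\<forall>a\<in>A. \<exists>b\<in>B. dist a b \<le> r) \<and> (\<forall>b\<in>B. \<exists>a\<in>A. dist a b \<le> r)"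
  using excess_le_iff[OF assms, of r] excess_le_iff[OF assms(2,1), of r]
  unfolding hausdorff_def max.bounded_iff by (metis dist_commute)

lemma hausdorff_nearest:
  assumes "A \<in> compacts" "B \<in> compacts" "a \<in> A"
  shows "\<exists>b\<in>B. dist a b \<le> hausdorff A B"
  using hausdorff_le_iff[OF assms(1,2), of "hausdorff A B"] assms(3) by blast

lemma hausdorff_commute: "hausdorff A B = hausdorff B A"
  by (simp add: hausdorff_def max.commute)

lemma hausdorff_nonneg:
  assumes "A \<in> compacts" "B \<in> compacts"
  shows "0 \<le> hausdorff A B"
proof -
  obtain a where "a \<in> A" using assms by (auto simp: compacts_def)
  then obtain b where "dist a b \<le> hausdorff A B" using hausdorff_nearest[OF assms] by blast
  then show ?thesis using zero_le_dist[of a b] by linarith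
qed

lemma hausdorff_triangle:
  assumes A: "A \<in> compacts" and B: "B \<in> compacts" and C: "C \<in> compacts"
  shows "hausdorff A C \<le> hausdorff A B + hausdorff B C"
proof -
  have *: "\<exists>c\<in>C. dist a c \<le> hausdorff A B + hausdorff B C"
    if A: "A \<in> compacts" and B: "B \<in> compacts" and C: "C \<in> compacts" and a: "a \<in> A"
    for A B C :: "'a set" and a
  proof -
    obtain b where b: "b \<in> B" "dist a b \<le> hausdorff A B"
      using hausdorff_nearest[OF A B a] by blast
    obtain c where c: "c \<in> C" "dist b c \<le> hausdorff B C"
      using hausdorff_nearest[OF B C b(1)] by blast
    show ?thesis
      using b c by (intro bexI[of _ c]) (use dist_triangle[of a c b] in linarith)
  qed
  have "\<exists>a\<in>A. dist a c \<le> hausdorff A B + hausdorff B C" if "c \<in> C" for c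
    using *[OF C B A that] by (simp only: hausdorff_commute[of C] hausdorff_commute[of B A]
        dist_commute[of c] add.commute)
  with *[OF A B C] show ?thesis unfolding hausdorff_le_iff[OF A C] by blast
qed

lemma hausdorff_eq_0_imp_eq:
  assumes "A \<in> compacts" "B \<in> compacts" "hausdorff A B \<le> 0"
  shows "A = B"
  using assms hausdorff_le_iff[OF assms(1,2), of 0] by auto

lemma hausdorff_singletons: "hausdorff {a} {b} = dist a b"
  by (simp add: hausdorff_def excess_def dist_commute)

lemma hausdorff_mscale:
  assumes "A \<in> compacts" "B \<in> compacts"
  shows "hausdorff (mscale c A) (mscale c B) \<le> \<bar>c\<bar> * hausdorff A B"
proof -
  have "\<exists>b\<in>B. dist (c *\<^sub>R a) (c *\<^sub>R b) \<le> \<bar>c\<bar> * hausdorff A B"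
    if "A \<in> compacts" "B \<in> compacts" "a \<in> A" for A B :: "'a set" and a
  proof -
    obtain b where "b \<in> B" "dist a b \<le> hausdorff A B"
      using hausdorff_nearest[OF \<open>A \<in> compacts\<close> \<open>B \<in> compacts\<close> \<open>a \<in> A\<close>] by blast
    moreover have "dist (c *\<^sub>R a) (c *\<^sub>R b) = \<bar>c\<bar> * dist a b"
      by (simp add: dist_norm flip: scaleR_diff_right)
    ultimately show ?thesis by (metis abs_ge_zero mult_left_mono)
  qed
  from this[OF assms] this[OF assms(2,1)] show ?thesis
    unfolding hausdorff_le_iff[OF compacts_mscale[OF assms(1)] compacts_mscale[OF assms(2)]]
    by (simp only: mscale_def ball_simps bex_simps hausdorff_commute[of B] dist_commute) blast
qed

lemma hausdorff_mscale_same: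
  assumes A: "A \<in> compacts" and M: "\<And>a. a \<in> A \<Longrightarrow> norm a \<le> M"
  shows "hausdorff (mscale p A) (mscale q A) \<le> \<bar>p - q\<bar> * M"
proof -
  have "dist (p *\<^sub>R a) (q *\<^sub>R a) \<le> \<bar>p - q\<bar> * M" if "a \<in> A" for a
    using M[OF that]
    by (simp add: dist_norm scaleR_diff_left[symmetric] mult_left_mono)
  then show ?thesis
    unfolding hausdorff_le_iff[OF compacts_mscale[OF A] compacts_mscale[OF A]]
    by (simp only: mscale_def ball_simps bex_simps) blast
qed

text \<open>Completeness of the space of compact sets. A limit is given by the set of cluster points of
  sequences of points taken from the tails, which avoids a choice of rapidly converging
  selections.\<close>

lemma hausdorff_complete:
  fixes S :: "nat \<Rightarrow> 'a::euclidean_space set"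
  assumes S: "\<And>n. S n \<in> compacts"
    and Cauchy: "\<And>e. e > 0 \<Longrightarrow> \<exists>N. \<forall>m\<ge>N. \<forall>n\<ge>N. hausdorff (S m) (S n) \<le> e"
  obtains I where "I \<in> compacts" "(\<lambda>n. hausdorff (S n) I) \<longlonglongrightarrow> 0"
proof -
  define I where "I = (\<Inter>N. closure (\<Union>p\<in>{N..}. S p))"
  \<comment> \<open>All sets of a tail lie in the closed \<open>e\<close>-neighbourhood of each of them.\<close>
  have enlarge: "closure (\<Union>p\<in>{N..}. S p) \<subseteq> {y. infdist y (S n) \<le> e}"
    if "n \<ge> N" and le: "\<forall>m\<ge>N. \<forall>n\<ge>N. hausdorff (S m) (S n) \<le> e" for N n e
  proof (rule closure_minimal)
    show "(\<Union>p\<in>{N..}. S p) \<subseteq> {y. infdist y (S n) \<le> e}"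
    proof clarsimp
      fix p y assume "N \<le> p" "y \<in> S p"
      then obtain z where "z \<in> S n" "dist y z \<le> hausdorff (S p) (S n)"
        using hausdorff_nearest[OF S S \<open>y \<in> S p\<close>] by blast
      moreover have "hausdorff (S p) (S n) \<le> e" using le \<open>N \<le> p\<close> \<open>N \<le> n\<close> by blast
      ultimately show "infdist y (S n) \<le> e" using infdist_le2[of z "S n" y e] by linarith
    qed
    show "closed {y. infdist y (S n) \<le> e}"
      by (intro closed_Collect_le continuous_intros)
  qed
  have upper: "\<exists>z\<in>S n. dist y z \<le> e"
    if "n \<ge> N" "\<forall>m\<ge>N. \<forall>n\<ge>N. hausdorff (S m) (S n) \<le> e" "y \<in> I" for N n e y
  proof -
    have "y \<in> closure (\<Union>p\<in>{N..}. S p)" using that(3) unfolding I_def by blast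
    then have "infdist y (S n) \<le> e" using enlarge[OF that(1,2)] by blast
    moreover have "closed (S n)" "S n \<noteq> {}"
      using S[of n] by (simp_all add: compacts_def compact_imp_closed)
    ultimately show ?thesis using infdist_attains_inf[of "S n" y] by metis
  qed
  have lower: "\<exists>z\<in>I. dist y z \<le> e"
    if n: "n \<ge> N" and le: "\<forall>m\<ge>N. \<forall>n\<ge>N. hausdorff (S m) (S n) \<le> e" and y: "y \<in> S n" for N n e y
  proof -
    \<comment> \<open>A point of \<open>I\<close> near \<open>y\<close> is the limit of a subsequence of points of the later sets near \<open>y\<close>.\<close>
    have "\<exists>z. z \<in> S (n + p) \<and> dist y z \<le> e" for p
    proof -
      obtain z where "z \<in> S (n + p)" "dist y z \<le> hausdorff (S n) (S (n + p))"
        using hausdorff_nearest[OF S S y] by blast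
      moreover have "hausdorff (S n) (S (n + p)) \<le> e" using le n by simp
      ultimately show ?thesis using order_trans by blast
    qed
    then obtain z where z: "\<And>p. z p \<in> S (n + p)" "\<And>p. dist y (z p) \<le> e"
      by metis
    have "\<forall>p. z p \<in> cball y e" using z by simp
    then have "\<exists>l\<in>cball y e. \<exists>r. strict_mono r \<and> (z \<circ> r) \<longlonglongrightarrow> l"
      using compact_cball[of y e] unfolding compact_def by metis
    then obtain l r where l: "l \<in> cball y e" "strict_mono r" "(z \<circ> r) \<longlonglongrightarrow> l"
      by blast
    have "l \<in> closure (\<Union>p\<in>{M..}. S p)" for M
    proof (rule Lim_in_closed_set[OF closed_closure _ _ l(3)])
      have "(z \<circ> r) k \<in> closure (\<Union>p\<in>{M..}. S p)" if "k \<ge> M" for k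
      proof -
        have "r k \<ge> M" using seq_suble[OF l(2), of k] that by linarith
        then have "n + r k \<in> {M..}" by simp
        then have "(z \<circ> r) k \<in> (\<Union>p\<in>{M..}. S p)" unfolding comp_def using z(1)[of "r k"] by blast
        then show ?thesis using closure_subset[of "\<Union>p\<in>{M..}. S p"] by blast
      qed
      then show "\<forall>\<^sub>F k in sequentially. (z \<circ> r) k \<in> closure (\<Union>p\<in>{M..}. S p)"
        unfolding eventually_sequentially by blast
    qed simp
    then have "l \<in> I" unfolding I_def by blast
    with l(1) show ?thesis by auto
  qed
  obtain N1 where N1: "\<forall>m\<ge>N1. \<forall>n\<ge>N1. hausdorff (S m) (S n) \<le> 1"
    using Cauchy[of 1] by auto
  have "closed I" unfolding I_def by blast
  moreover have "bounded I"
  proof -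
    have "bounded (S N1)" using S[of N1] by (simp add: compacts_def compact_imp_bounded)
    then obtain B where B: "\<forall>z\<in>S N1. norm z \<le> B" by (auto simp: bounded_iff)
    have "norm y \<le> B + 1" if y: "y \<in> I" for y
    proof -
      obtain z where "z \<in> S N1" "dist y z \<le> 1" using upper[OF order_refl N1 y] by auto
      moreover from this have "norm z \<le> B" using B by blast
      ultimately show ?thesis using norm_triangle_sub[of y z] by (simp add: dist_norm)
    qed
    then show ?thesis by (auto simp: bounded_iff)
  qed
  moreover have "I \<noteq> {}"
  proof -
    obtain y where "y \<in> S N1" using S by (auto simp: compacts_def)
    from lower[OF order_refl N1 this] show ?thesis by auto
  qed
  ultimately have I: "I \<in> compacts" by (auto simp: compacts_def compact_eq_bounded_closed)
  moreover have "(\<lambda>n. hausdorff (S n) I) \<longlonglongrightarrow> 0"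
  proof (rule LIMSEQ_I)
    fix e :: real assume "e > 0"
    then obtain N where N: "\<forall>m\<ge>N. \<forall>n\<ge>N. hausdorff (S m) (S n) \<le> e / 2"
      using Cauchy[of "e / 2"] by auto
    have "norm (hausdorff (S n) I - 0) < e" if "n \<ge> N" for n
    proof -
      have "\<exists>z\<in>S n. dist z y \<le> e / 2" if "y \<in> I" for y
        using upper[OF \<open>n \<ge> N\<close> N that] by (simp only: dist_commute[of y])
      with lower[OF that N] have "hausdorff (S n) I \<le> e / 2"
        unfolding hausdorff_le_iff[OF S I] by blast
      then show ?thesis using \<open>e > 0\<close> hausdorff_nonneg[OF S I, of n] by simp
    qed
    then show "\<exists>N. \<forall>n\<ge>N. norm (hausdorff (S n) I - 0) < e" by blast
  qed
  ultimately show ?thesis by (rule that)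
qed

section \<open>Support functions\<close>

text \<open>The support function of a nonempty compact set, evaluated at an arbitrary vector.\<close>

definition supp :: "'a::euclidean_space set \<Rightarrow> 'a \<Rightarrow> real" where
  "supp A u = (SUP a\<in>A. u \<bullet> a)"

lemma supp_attained:
  assumes "A \<in> compacts"
  obtains a where "a \<in> A" "supp A u = u \<bullet> a" "\<And>b. b \<in> A \<Longrightarrow> u \<bullet> b \<le> u \<bullet> a"
proof -
  have "continuous_on A (\<lambda>a. u \<bullet> a)" by (intro continuous_intros)
  then obtain a where a: "a \<in> A" "\<forall>b\<in>A. u \<bullet> b \<le> u \<bullet> a"
    using continuous_attains_sup[of A "\<lambda>a. u \<bullet> a"] assms unfolding compacts_def by blast
  moreover have "supp A u = u \<bullet> a"
    unfolding supp_def using a by (intro cSup_eq_maximum) auto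
  ultimately show ?thesis using that by blast
qed

lemma supp_upper: "A \<in> compacts \<Longrightarrow> a \<in> A \<Longrightarrow> u \<bullet> a \<le> supp A u"
  by (metis supp_attained)

lemma supp_eqI: "a \<in> A \<Longrightarrow> (\<And>b. b \<in> A \<Longrightarrow> u \<bullet> b \<le> u \<bullet> a) \<Longrightarrow> supp A u = u \<bullet> a"
  unfolding supp_def by (intro cSup_eq_maximum) auto

lemma supp_singleton [simp]: "supp {a} u = u \<bullet> a"
  by (intro supp_eqI) auto

lemma supp_plus:
  assumes "A \<in> compacts" "B \<in> compacts"
  shows "supp (A + B) u = supp A u + supp B u"
proof -
  obtain a where a: "a \<in> A" "supp A u = u \<bullet> a" "\<And>b. b \<in> A \<Longrightarrow> u \<bullet> b \<le> u \<bullet> a"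
    using supp_attained[OF assms(1)] by blast
  obtain b where b: "b \<in> B" "supp B u = u \<bullet> b" "\<And>c. c \<in> B \<Longrightarrow> u \<bullet> c \<le> u \<bullet> b"
    using supp_attained[OF assms(2)] by blast
  have "supp (A + B) u = u \<bullet> (a + b)"
  proof (rule supp_eqI)
    show "u \<bullet> c \<le> u \<bullet> (a + b)" if "c \<in> A + B" for c
      using that a b by (elim set_plus_elim) (auto simp: inner_add_right intro: add_mono)
  qed (use a b in blast)
  then show ?thesis using a b by (simp add: inner_add_right)
qed

lemma supp_sum:
  assumes "\<And>k. k \<in> K \<Longrightarrow> A k \<in> compacts"
  shows "supp (\<Sum>k\<in>K. A k) u = (\<Sum>k\<in>K. supp (A k) u)"
  using assms
proof (induction K rule: infinite_finite_induct)
  case (insert k K)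
  then show ?case by (simp add: supp_plus compacts_sum)
qed simp_all

lemma supp_mscale:
  assumes "A \<in> compacts" "c \<ge> 0"
  shows "supp (mscale c A) u = c * supp A u"
proof -
  obtain a where "a \<in> A" "supp A u = u \<bullet> a" "\<And>b. b \<in> A \<Longrightarrow> u \<bullet> b \<le> u \<bullet> a"
    using supp_attained[OF assms(1)] by blast
  then have "supp (mscale c A) u = u \<bullet> (c *\<^sub>R a)"
    using assms(2) by (intro supp_eqI) (auto simp: mscale_def mult_left_mono)
  with \<open>supp A u = u \<bullet> a\<close> show ?thesis by simp
qed

lemma supp_convex_hull:
  assumes "A \<in> compacts"
  shows "supp (convex hull A) u = supp A u"
proof -
  obtain a where a: "a \<in> A" "supp A u = u \<bullet> a" "\<And>b. b \<in> A \<Longrightarrow> u \<bullet> b \<le> u \<bullet> a"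
    using supp_attained[OF assms(1)] by blast
  then have "convex hull A \<subseteq> {b. u \<bullet> b \<le> u \<bullet> a}"
    by (intro hull_minimal convex_halfspace_le) auto
  then show ?thesis
    using supp_eqI[of a "convex hull A" u] a hull_inc[of a A] by auto
qed

lemma supp_diff_le_hausdorff:
  assumes "A \<in> compacts" "B \<in> compacts"
  shows "\<bar>supp A u - supp B u\<bar> \<le> norm u * hausdorff A B"
proof -
  have "supp A u - supp B u \<le> norm u * hausdorff A B"
    if A: "A \<in> compacts" and B: "B \<in> compacts" for A B :: "'a set"
  proof -
    obtain a where a: "a \<in> A" "supp A u = u \<bullet> a"
      using supp_attained[OF A] by blast
    obtain b where b: "b \<in> B" "dist a b \<le> hausdorff A B"
      using hausdorff_nearest[OF A B a(1)] by blast
    have "supp A u - supp B u \<le> u \<bullet> (a - b)"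
      using supp_upper[OF B b(1), of u] a by (simp add: inner_diff_right)
    also have "\<dots> \<le> norm u * norm (a - b)" by (rule norm_cauchy_schwarz)
    also have "\<dots> \<le> norm u * hausdorff A B"
      using b by (intro mult_left_mono) (auto simp: dist_norm)
    finally show ?thesis .
  qed
  from this[OF assms] this[OF assms(2,1)] show ?thesis
    by (simp add: abs_le_iff hausdorff_commute)
qed

text \<open>Conversely, the Hausdorff distance of convex compact sets is controlled by their support
  functions on the unit ball, because the vector from a point to its metric projection is normal to
  a supporting hyperplane.\<close>

lemma hausdorff_le_supp:
  assumes A: "A \<in> compacts" "convex A" and B: "B \<in> compacts" "convex B"
    and r: "\<And>u. norm u \<le> 1 \<Longrightarrow> \<bar>supp A u - supp B u\<bar> \<le> r"
  shows "hausdorff A B \<le> r"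
proof -
  have *: "\<exists>b\<in>B. dist a b \<le> r"
    if A: "A \<in> compacts" and B: "B \<in> compacts" "convex B" and a: "a \<in> A"
      and r: "\<And>u. norm u \<le> 1 \<Longrightarrow> \<bar>supp A u - supp B u\<bar> \<le> r" for A B :: "'a set" and a
  proof -
    define b where "b = closest_point B a"
    define u where "u = sgn (a - b)"
    have B': "closed B" "B \<noteq> {}" using B by (auto simp: compacts_def compact_imp_closed)
    have b: "b \<in> B" unfolding b_def using B' by (rule closest_point_in_set)
    have "u \<bullet> c \<le> u \<bullet> b" if "c \<in> B" for c
    proof -
      have "(a - b) \<bullet> (c - b) \<le> 0"
        unfolding b_def by (rule closest_point_dot[OF B(2) B'(1) that])
      then have "u \<bullet> (c - b) \<le> 0"
        by (simp add: u_def sgn_div_norm mult_nonneg_nonpos)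
      then show ?thesis by (simp add: inner_diff_right)
    qed
    with b have "supp B u = u \<bullet> b" by (rule supp_eqI)
    moreover have "norm (a - b) = u \<bullet> (a - b)"
      by (cases "a = b") (simp_all add: u_def sgn_div_norm dot_square_norm power2_eq_square)
    moreover have "norm u \<le> 1" by (simp add: u_def norm_sgn)
    ultimately have "dist a b \<le> r"
      using supp_upper[OF A a, of u] r[of u] by (simp add: dist_norm inner_diff_right)
    with b show ?thesis by blast
  qed
  have "\<bar>supp B u - supp A u\<bar> \<le> r" if "norm u \<le> 1" for u
    using r[OF that] by (simp add: abs_minus_commute)
  then have "\<exists>a\<in>A. dist a b \<le> r" if "b \<in> B" for b
    using *[OF B(1) A that] by (simp only: dist_commute[of b])
  with *[OF A(1) B _ r] show ?thesis
    unfolding hausdorff_le_iff[OF A(1) B(1)] by blast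
qed

lemma hausdorff_convex_hull_le:
  assumes "A \<in> compacts" "B \<in> compacts"
  shows "hausdorff (convex hull A) (convex hull B) \<le> hausdorff A B"
proof (rule hausdorff_le_supp)
  fix u :: 'a assume "norm u \<le> 1"
  then have "norm u * hausdorff A B \<le> hausdorff A B"
    using hausdorff_nonneg[OF assms] by (simp add: mult_left_le_one_le)
  then show "\<bar>supp (convex hull A) u - supp (convex hull B) u\<bar> \<le> hausdorff A B"
    using supp_diff_le_hausdorff[OF assms, of u] by (simp add: supp_convex_hull assms)
qed (simp_all add: assms compacts_convex_hull)

section \<open>Minkowski sums of many small sets are almost convex\<close>

text \<open>A variant of the Shapley--Folkman theorem: points of the convex hulls can be replaced by
  points of the sets themselves, and the resulting errors add up only in the square. The points are
  chosen one after another, each so that its error has nonpositive inner product with the error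
  accumulated before.\<close>

lemma shapley_folkman:
  fixes A :: "'i \<Rightarrow> 'a::real_inner set"
  assumes "finite K" "\<And>i. i \<in> K \<Longrightarrow> z i \<in> convex hull (A i)"
    and "\<And>i a. i \<in> K \<Longrightarrow> a \<in> A i \<Longrightarrow> norm a \<le> D i"
  shows "\<exists>s. (\<forall>i\<in>K. s i \<in> A i) \<and> (norm ((\<Sum>i\<in>K. s i) - (\<Sum>i\<in>K. z i)))\<^sup>2 \<le> (\<Sum>i\<in>K. (2 * D i)\<^sup>2)"
  using assms
proof (induction K rule: finite_induct)
  case (insert k K)
  then obtain s where s: "\<forall>i\<in>K. s i \<in> A i"
    "(norm ((\<Sum>i\<in>K. s i) - (\<Sum>i\<in>K. z i)))\<^sup>2 \<le> (\<Sum>i\<in>K. (2 * D i)\<^sup>2)" by auto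
  define e where "e = (\<Sum>i\<in>K. s i) - (\<Sum>i\<in>K. z i)"
  have zk: "z k \<in> convex hull (A k)" using insert by simp
  \<comment> \<open>Otherwise an open half-space would contain \<open>A k\<close>, hence its convex hull, but not \<open>z k\<close>.\<close>
  have "\<exists>a\<in>A k. e \<bullet> a \<le> e \<bullet> z k"
  proof (rule ccontr)
    assume "\<not> ?thesis"
    then have "convex hull (A k) \<subseteq> {a. e \<bullet> a > e \<bullet> z k}"
      by (intro hull_minimal convex_halfspace_gt) auto
    then show False using zk by auto
  qed
  then obtain a where a: "a \<in> A k" "e \<bullet> a \<le> e \<bullet> z k" by blast
  have "convex hull (A k) \<subseteq> cball 0 (D k)"
    using insert.prems by (intro hull_minimal) auto
  then have "norm (z k) \<le> D k" using zk by auto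
  moreover have "norm a \<le> D k" using insert.prems a by simp
  ultimately have "norm (a - z k) \<le> 2 * D k"
    using norm_triangle_ineq4[of a "z k"] by linarith
  then have "(norm (a - z k))\<^sup>2 \<le> (2 * D k)\<^sup>2" by (intro power_mono) auto
  moreover have "(norm (e + (a - z k)))\<^sup>2 = (norm e)\<^sup>2 + 2 * (e \<bullet> (a - z k)) + (norm (a - z k))\<^sup>2"
    by (simp add: dot_norm field_simps)
  ultimately have "(norm (e + (a - z k)))\<^sup>2 \<le> (\<Sum>i\<in>insert k K. (2 * D i)\<^sup>2)"
    using a s insert.hyps by (simp add: e_def inner_diff_right)
  moreover have "(\<Sum>i\<in>K. (s(k := a)) i) = (\<Sum>i\<in>K. s i)"
    using insert.hyps by (intro sum.cong) auto
  then have "(\<Sum>i\<in>insert k K. (s(k := a)) i) - (\<Sum>i\<in>insert k K. z i) = e + (a - z k)"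
    using insert.hyps by (simp add: e_def)
  ultimately have "(norm ((\<Sum>i\<in>insert k K. (s(k := a)) i) - (\<Sum>i\<in>insert k K. z i)))\<^sup>2
      \<le> (\<Sum>i\<in>insert k K. (2 * D i)\<^sup>2)" by presburger
  moreover have "\<forall>i\<in>insert k K. (s(k := a)) i \<in> A i" using s(1) a(1) by simp
  ultimately show ?case by blast
qed simp

lemma hausdorff_sum_convex_hull:
  fixes A :: "'i \<Rightarrow> 'a::euclidean_space set"
  assumes "finite K" and A: "\<And>i. i \<in> K \<Longrightarrow> A i \<in> compacts"
    and D: "\<And>i a. i \<in> K \<Longrightarrow> a \<in> A i \<Longrightarrow> norm a \<le> D i"
  shows "hausdorff (\<Sum>i\<in>K. A i) (convex hull (\<Sum>i\<in>K. A i)) \<le> sqrt (\<Sum>i\<in>K. (2 * D i)\<^sup>2)"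
proof -
  have S: "(\<Sum>i\<in>K. A i) \<in> compacts" using A by (rule compacts_sum)
  have "\<exists>s\<in>(\<Sum>i\<in>K. A i). dist s y \<le> sqrt (\<Sum>i\<in>K. (2 * D i)\<^sup>2)"
    if "y \<in> convex hull (\<Sum>i\<in>K. A i)" for y
  proof -
    have "y \<in> (\<Sum>i\<in>K. convex hull (A i))" using that by (simp add: convex_hull_set_sum)
    then obtain z where z: "y = sum z K" "\<And>i. i \<in> K \<Longrightarrow> z i \<in> convex hull (A i)"
      unfolding set_sum_alt[OF \<open>finite K\<close>] by blast
    obtain s where "\<forall>i\<in>K. s i \<in> A i"
      "(norm ((\<Sum>i\<in>K. s i) - (\<Sum>i\<in>K. z i)))\<^sup>2 \<le> (\<Sum>i\<in>K. (2 * D i)\<^sup>2)"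
      using shapley_folkman[of K z A D] \<open>finite K\<close> z(2) D by blast
    then show ?thesis
      using \<open>finite K\<close> z(1)
      by (intro bexI[of _ "sum s K"]) (auto simp: set_sum_alt dist_norm intro: real_le_rsqrt)
  qed
  moreover have "\<exists>b\<in>convex hull (\<Sum>i\<in>K. A i). dist a b \<le> sqrt (\<Sum>i\<in>K. (2 * D i)\<^sup>2)"
    if "a \<in> (\<Sum>i\<in>K. A i)" for a
    using that by (intro bexI[of _ a]) (auto intro: hull_inc sum_nonneg)
  ultimately show ?thesis
    unfolding hausdorff_le_iff[OF S compacts_convex_hull[OF S]] by blast
qed

section \<open>Integrals of continuous set-valued functions\<close>

text \<open>A set-valued function on \<open>[0,1]\<close> with nonempty compact values that is continuous in the
  Hausdorff metric. Continuity is stated in its uniform form, which is equivalent on a compact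
  interval.\<close>

definition set_continuous :: "(real \<Rightarrow> 'a::euclidean_space set) \<Rightarrow> bool" where
  "set_continuous g \<longleftrightarrow> (\<forall>x\<in>{0..1}. g x \<in> compacts) \<and>
     (\<forall>e>0. \<exists>d>0. \<forall>x\<in>{0..1}. \<forall>y\<in>{0..1}. \<bar>x - y\<bar> < d \<longrightarrow> hausdorff (g x) (g y) \<le> e)"

lemma set_continuous_compacts: "set_continuous g \<Longrightarrow> x \<in> {0..1} \<Longrightarrow> g x \<in> compacts"
  by (simp add: set_continuous_def)

lemma continuous_on_hausdorff_bound:
  fixes \<phi> :: "real \<Rightarrow> real"
  assumes g: "set_continuous g" and C: "C \<ge> 0"
    and \<phi>: "\<And>x y. x \<in> {0..1} \<Longrightarrow> y \<in> {0..1} \<Longrightarrow> \<bar>\<phi> x - \<phi> y\<bar> \<le> C * hausdorff (g x) (g y)"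
  shows "continuous_on {0..1} \<phi>"
proof -
  have "\<exists>d>0. \<forall>y\<in>{0..1}. dist y x < d \<longrightarrow> dist (\<phi> y) (\<phi> x) < e"
    if x: "x \<in> {0..1}" and e: "e > 0" for x e
  proof -
    have "e / (C + 1) > 0" using e C by simp
    then obtain d where d: "d > 0"
      "\<forall>x\<in>{0..1}. \<forall>y\<in>{0..1}. \<bar>x - y\<bar> < d \<longrightarrow> hausdorff (g x) (g y) \<le> e / (C + 1)"
      using g unfolding set_continuous_def by blast
    have "\<bar>\<phi> y - \<phi> x\<bar> < e" if y: "y \<in> {0..1}" "\<bar>y - x\<bar> < d" for y
    proof -
      have "C * hausdorff (g y) (g x) \<le> C * (e / (C + 1))"
        using d(2) x y C by (intro mult_left_mono) auto
      also have "\<dots> < e" using C e by (simp add: field_simps)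
      finally show ?thesis using \<phi>[OF y(1) x] by linarith
    qed
    with d(1) show ?thesis by (auto simp: dist_real_def)
  qed
  then show ?thesis unfolding continuous_on_iff by blast
qed

lemma set_continuous_bounded:
  assumes g: "set_continuous g"
  obtains M where "M \<ge> 0" "\<And>x a. x \<in> {0..1} \<Longrightarrow> a \<in> g x \<Longrightarrow> norm a \<le> M"
proof -
  have "\<bar>hausdorff (g x) {0} - hausdorff (g y) {0}\<bar> \<le> 1 * hausdorff (g x) (g y)"
    if "x \<in> {0..1}" "y \<in> {0..1}" for x y
    using hausdorff_triangle[of "g x" "g y" "{0}"] hausdorff_triangle[of "g y" "g x" "{0}"]
      set_continuous_compacts[OF g that(1)] set_continuous_compacts[OF g that(2)]
    by (simp add: hausdorff_commute[of "g y" "g x"])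
  then have "continuous_on {0..1} (\<lambda>x. hausdorff (g x) {0})"
    by (intro continuous_on_hausdorff_bound[OF g, of 1]) auto
  then have "bounded ((\<lambda>x. hausdorff (g x) {0}) ` {0..1})"
    by (intro compact_imp_bounded compact_continuous_image) auto
  then obtain M where M: "\<forall>x\<in>{0..1}. \<bar>hausdorff (g x) {0}\<bar> \<le> M"
    by (auto simp: bounded_iff)
  have "norm a \<le> M" if "x \<in> {0..1}" "a \<in> g x" for x a
  proof -
    have "dist a 0 \<le> hausdorff (g x) {0}"
      using hausdorff_nearest[of "g x" "{0}" a] set_continuous_compacts[OF g that(1)] that(2) by simp
    also have "\<dots> \<le> M" using M that(1) by (auto simp: abs_le_iff)
    finally show ?thesis by simp
  qed
  moreover have "M \<ge> 0" using M by force
  ultimately show ?thesis using that by blast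
qed

lemma continuous_on_supp:
  assumes "set_continuous g"
  shows "continuous_on {0..1} (\<lambda>x. supp (g x) u)"
  by (rule continuous_on_hausdorff_bound[OF assms, of "norm u"])
    (simp_all add: supp_diff_le_hausdorff set_continuous_compacts[OF assms])

lemma tagged_partition01_bounds:
  assumes "tagged_partition01 N t \<xi>" "i \<le> N"
  shows "t i \<in> {0..1}"
proof -
  have step: "t i \<le> t (Suc i)" if "i < N" for i
    using assms(1) that unfolding tagged_partition01_def
    by (auto dest!: bspec[of _ _ "Suc i"])
  have "0 \<le> t i" using assms(2)
  proof (induction i)
    case 0
    then show ?case using assms(1) by (simp add: tagged_partition01_def)
  next
    case (Suc i)
    then show ?case using step[of i] by simp
  qed
  moreover have "t i \<le> t N" using assms(2)
  proof (induction rule: inc_induct)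
    case (step n)
    then show ?case using \<open>\<And>i. i < N \<Longrightarrow> t i \<le> t (Suc i)\<close>[of n] by linarith
  qed simp
  ultimately show ?thesis using assms(1) by (simp add: tagged_partition01_def)
qed

lemma tagged_partition01_tag:
  assumes "tagged_partition01 N t \<xi>" "i \<in> {1..N}"
  shows "t (i - 1) < t i" "\<xi> i \<in> {t (i - 1)..t i}" "\<xi> i \<in> {0..1}"
proof -
  show *: "t (i - 1) < t i" "\<xi> i \<in> {t (i - 1)..t i}"
    using assms by (simp_all add: tagged_partition01_def)
  have "t i \<in> {0..1}" "t (i - 1) \<in> {0..1}"
    using tagged_partition01_bounds[OF assms(1)] assms(2) by auto
  with * show "\<xi> i \<in> {0..1}" by simp
qed

lemma tagged_partition01_sum:
  assumes "tagged_partition01 N t \<xi>"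
  shows "(\<Sum>i=1..N. t i - t (i - 1)) = 1"
proof -
  have "(\<Sum>i=1..j. t i - t (i - 1)) = t j - t 0" for j
    by (induction j) auto
  then show ?thesis using assms by (simp add: tagged_partition01_def)
qed

lemma tagged_partition01_uniform:
  "tagged_partition01 (Suc n) (\<lambda>i. real i / real (Suc n)) (\<lambda>i. real i / real (Suc n))"
  by (auto simp: tagged_partition01_def field_simps)

lemma riemann_sum_error:
  fixes \<phi> :: "real \<Rightarrow> real"
  assumes tp: "tagged_partition01 N t \<xi>" and mesh: "\<forall>i\<in>{1..N}. t i - t (i - 1) < d"
    and cont: "continuous_on {0..1} \<phi>"
    and \<phi>: "\<And>x y. x \<in> {0..1} \<Longrightarrow> y \<in> {0..1} \<Longrightarrow> \<bar>x - y\<bar> < d \<Longrightarrow> \<bar>\<phi> x - \<phi> y\<bar> \<le> \<eta>"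
  shows "\<bar>(\<Sum>i=1..N. (t i - t (i - 1)) * \<phi> (\<xi> i)) - integral {0..1} \<phi>\<bar> \<le> \<eta>"
proof -
  have t0: "t 0 = 0" "t N = 1" using tp by (simp_all add: tagged_partition01_def)
  have "\<bar>(\<Sum>i=1..j. (t i - t (i - 1)) * \<phi> (\<xi> i)) - integral {0..t j} \<phi>\<bar> \<le> \<eta> * t j" if "j \<le> N" for j
    using that
  proof (induction j)
    case 0
    then show ?case by (simp add: t0)
  next
    case (Suc j)
    have tj: "t j \<in> {0..1}" "t (Suc j) \<in> {0..1}"
      using tagged_partition01_bounds[OF tp] Suc.prems by simp_all
    have tag: "t j < t (Suc j)" "\<xi> (Suc j) \<in> {t j..t (Suc j)}" "\<xi> (Suc j) \<in> {0..1}"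
      using tagged_partition01_tag[OF tp, of "Suc j"] Suc.prems by simp_all
    have short: "t (Suc j) - t j < d" using mesh Suc.prems by (auto dest: bspec[of _ _ "Suc j"])
    have sub: "continuous_on {t j..t (Suc j)} \<phi>"
      using cont tj by (elim continuous_on_subset) auto
    have "continuous_on {0..t (Suc j)} \<phi>"
      using cont tj by (elim continuous_on_subset) auto
    then have split: "integral {0..t j} \<phi> + integral {t j..t (Suc j)} \<phi> = integral {0..t (Suc j)} \<phi>"
      using tj tag by (intro Henstock_Kurzweil_Integration.integral_combine integrable_continuous_real) auto
    have "norm (integral {t j..t (Suc j)} (\<lambda>x. \<phi> x - \<phi> (\<xi> (Suc j)))) \<le> \<eta> * (t (Suc j) - t j)"
    proof (rule integral_bound)
      show "continuous_on {t j..t (Suc j)} (\<lambda>x. \<phi> x - \<phi> (\<xi> (Suc j)))"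
        using sub by (intro continuous_intros)
      show "norm (\<phi> x - \<phi> (\<xi> (Suc j))) \<le> \<eta>" if "x \<in> {t j..t (Suc j)}" for x
        unfolding real_norm_def using that tag tj short by (intro \<phi>) auto
    qed (use tag in simp)
    moreover have "integral {t j..t (Suc j)} (\<lambda>x. \<phi> x - \<phi> (\<xi> (Suc j))) =
        integral {t j..t (Suc j)} \<phi> - (t (Suc j) - t j) * \<phi> (\<xi> (Suc j))"
      using sub tag by (subst integral_diff) (auto intro: integrable_continuous_real)
    ultimately have "\<bar>(t (Suc j) - t j) * \<phi> (\<xi> (Suc j)) - integral {t j..t (Suc j)} \<phi>\<bar>
        \<le> \<eta> * (t (Suc j) - t j)" by simp
    with Suc show ?case unfolding split[symmetric] by (simp add: right_diff_distrib)
  qed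
  from this[of N] show ?thesis by (simp add: t0)
qed

lemma rm_sum_compacts:
  assumes "set_continuous g" "tagged_partition01 N t \<xi>"
  shows "rm_sum g N t \<xi> \<in> compacts"
  unfolding rm_sum_def
  by (intro compacts_sum compacts_mscale set_continuous_compacts[OF assms(1)]
      tagged_partition01_tag[OF assms(2)])

lemma supp_rm_sum:
  assumes "set_continuous g" "tagged_partition01 N t \<xi>"
  shows "supp (rm_sum g N t \<xi>) u = (\<Sum>i=1..N. (t i - t (i - 1)) * supp (g (\<xi> i)) u)"
proof -
  have g: "g (\<xi> i) \<in> compacts" if "i \<in> {1..N}" for i
    using set_continuous_compacts[OF assms(1)] tagged_partition01_tag[OF assms(2) that] by blast
  then have "supp (rm_sum g N t \<xi>) u = (\<Sum>i=1..N. supp (mscale (t i - t (i - 1)) (g (\<xi> i))) u)"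
    unfolding rm_sum_def by (intro supp_sum compacts_mscale) auto
  also have "\<dots> = (\<Sum>i=1..N. (t i - t (i - 1)) * supp (g (\<xi> i)) u)"
    by (intro sum.cong supp_mscale refl g) (use tagged_partition01_tag[OF assms(2)] in fastforce)+
  finally show ?thesis .
qed

lemma rm_sum_almost_convex:
  assumes g: "set_continuous g" and tp: "tagged_partition01 N t \<xi>"
    and mesh: "\<forall>i\<in>{1..N}. t i - t (i - 1) < d"
    and M: "\<And>x a. x \<in> {0..1} \<Longrightarrow> a \<in> g x \<Longrightarrow> norm a \<le> M"
  shows "hausdorff (rm_sum g N t \<xi>) (convex hull (rm_sum g N t \<xi>)) \<le> sqrt (4 * M\<^sup>2 * d)"
proof -
  have "hausdorff (rm_sum g N t \<xi>) (convex hull (rm_sum g N t \<xi>))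
      \<le> sqrt (\<Sum>i=1..N. (2 * ((t i - t (i - 1)) * M))\<^sup>2)"
    unfolding rm_sum_def
  proof (rule hausdorff_sum_convex_hull)
    fix i assume i: "i \<in> {1..N}"
    show "mscale (t i - t (i - 1)) (g (\<xi> i)) \<in> compacts"
      using set_continuous_compacts[OF g] tagged_partition01_tag[OF tp i] compacts_mscale by blast
    show "norm a \<le> (t i - t (i - 1)) * M" if "a \<in> mscale (t i - t (i - 1)) (g (\<xi> i))" for a
      using that M tagged_partition01_tag[OF tp i] by (auto simp: mscale_def mult_left_mono)
  qed simp
  also have "(\<Sum>i=1..N. (2 * ((t i - t (i - 1)) * M))\<^sup>2) \<le> (\<Sum>i=1..N. 4 * M\<^sup>2 * d * (t i - t (i - 1)))"
  proof (rule sum_mono)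
    fix i assume i: "i \<in> {1..N}"
    define h where "h = t i - t (i - 1)"
    have "h * h \<le> d * h"
      using bspec[OF mesh i] tagged_partition01_tag(1)[OF tp i]
      by (intro mult_right_mono) (auto simp: h_def)
    then have "4 * M\<^sup>2 * (h * h) \<le> 4 * M\<^sup>2 * (d * h)" by (intro mult_left_mono) auto
    then show "(2 * ((t i - t (i - 1)) * M))\<^sup>2 \<le> 4 * M\<^sup>2 * d * (t i - t (i - 1))"
      unfolding h_def[symmetric] by (simp add: power2_eq_square mult_ac)
  qed
  also have "\<dots> = 4 * M\<^sup>2 * d"
    by (simp only: sum_distrib_left[symmetric] tagged_partition01_sum[OF tp] mult_1_right)
  finally show ?thesis by simp
qed

text \<open>Fine Riemann--Minkowski sums are almost convex, and their support functions are close to the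
  integral of the support functions of the values.\<close>

lemma rm_sum_fine:
  assumes g: "set_continuous g" and e: "e > 0"
  obtains d where "d > 0"
    "\<And>N t \<xi>. tagged_partition01 N t \<xi> \<Longrightarrow> \<forall>i\<in>{1..N}. t i - t (i - 1) < d \<Longrightarrow>
       hausdorff (rm_sum g N t \<xi>) (convex hull (rm_sum g N t \<xi>)) \<le> e"
    "\<And>N t \<xi> u. tagged_partition01 N t \<xi> \<Longrightarrow> \<forall>i\<in>{1..N}. t i - t (i - 1) < d \<Longrightarrow>
       \<bar>supp (rm_sum g N t \<xi>) u - integral {0..1} (\<lambda>x. supp (g x) u)\<bar> \<le> norm u * e"
proof -
  obtain M where M: "M \<ge> 0" "\<And>x a. x \<in> {0..1} \<Longrightarrow> a \<in> g x \<Longrightarrow> norm a \<le> M"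
    using set_continuous_bounded[OF g] by blast
  obtain d where d: "d > 0"
    "\<forall>x\<in>{0..1}. \<forall>y\<in>{0..1}. \<bar>x - y\<bar> < d \<longrightarrow> hausdorff (g x) (g y) \<le> e"
    using g e unfolding set_continuous_def by blast
  \<comment> \<open>The second bound makes \<open>sqrt (4 * M\<^sup>2 * d') \<le> e\<close>; adding \<open>1\<close> covers the case \<open>M = 0\<close>.\<close>
  define d' where "d' = min d (e\<^sup>2 / (4 * M\<^sup>2 + 1))"
  have pos: "4 * M\<^sup>2 + 1 > 0" by (simp add: add_nonneg_pos)
  show ?thesis
  proof (rule that)
    show "d' > 0" using d(1) e pos by (simp add: d'_def)
  next
    fix N t \<xi> assume tp: "tagged_partition01 N t \<xi>" and mesh: "\<forall>i\<in>{1..N}. t i - t (i - 1) < d'"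
    have "4 * M\<^sup>2 * d' \<le> 4 * M\<^sup>2 * (e\<^sup>2 / (4 * M\<^sup>2 + 1))"
      by (intro mult_left_mono) (auto simp: d'_def)
    also have "\<dots> \<le> e\<^sup>2" using pos by (simp add: field_simps)
    finally have "sqrt (4 * M\<^sup>2 * d') \<le> e" using e by (intro real_le_lsqrt) auto
    then show "hausdorff (rm_sum g N t \<xi>) (convex hull (rm_sum g N t \<xi>)) \<le> e"
      using rm_sum_almost_convex[OF g tp mesh, of M] M(2) by force
  next
    fix N t \<xi> u assume tp: "tagged_partition01 N t \<xi>" and mesh: "\<forall>i\<in>{1..N}. t i - t (i - 1) < d'"
    have "\<bar>supp (g x) u - supp (g y) u\<bar> \<le> norm u * e"
      if "x \<in> {0..1}" "y \<in> {0..1}" "\<bar>x - y\<bar> < d'" for x y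
    proof -
      have "hausdorff (g x) (g y) \<le> e" using d(2) that by (simp add: d'_def)
      then have "norm u * hausdorff (g x) (g y) \<le> norm u * e" by (intro mult_left_mono) auto
      then show ?thesis
        using supp_diff_le_hausdorff[of "g x" "g y" u] set_continuous_compacts[OF g] that by force
    qed
    from riemann_sum_error[OF tp mesh continuous_on_supp[OF g] this]
    show "\<bar>supp (rm_sum g N t \<xi>) u - integral {0..1} (\<lambda>x. supp (g x) u)\<bar> \<le> norm u * e"
      by (simp add: supp_rm_sum[OF g tp])
  qed
qed

lemma rm_sum_uniform_mesh:
  assumes "d > 0"
  obtains n0 where "\<And>n i. n \<ge> n0 \<Longrightarrow> i \<in> {1..Suc n} \<Longrightarrow>
    real i / real (Suc n) - real (i - 1) / real (Suc n) < d"
proof -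
  obtain n0 where n0: "1 / real (Suc n0) < d" using assms nat_approx_posE by blast
  have "real i / real (Suc n) - real (i - 1) / real (Suc n) < d"
    if "n \<ge> n0" "i \<in> {1..Suc n}" for n i
  proof -
    have "real i / real (Suc n) - real (i - 1) / real (Suc n) = 1 / real (Suc n)"
      using that(2) by (simp add: diff_divide_distrib[symmetric] of_nat_diff)
    also have "\<dots> \<le> 1 / real (Suc n0)" using that(1) by (intro divide_left_mono) auto
    finally show ?thesis using n0 by linarith
  qed
  then show ?thesis using that by blast
qed

lemma has_rm_integral_unique:
  assumes g: "set_continuous g" and I: "has_rm_integral g I" and J: "has_rm_integral g J"
  shows "I = J"
proof -
  have IJ: "I \<in> compacts" "J \<in> compacts" using I J by (simp_all add: has_rm_integral_def)
  have "hausdorff I J \<le> 0 + e" if e: "e > 0" for e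
  proof -
    obtain d1 where d1: "d1 > 0" "\<And>N t \<xi>. tagged_partition01 N t \<xi> \<Longrightarrow>
        \<forall>i\<in>{1..N}. t i - t (i - 1) < d1 \<Longrightarrow> hausdorff (rm_sum g N t \<xi>) I < e / 2"
      using I half_gt_zero[OF e] unfolding has_rm_integral_def by metis
    obtain d2 where d2: "d2 > 0" "\<And>N t \<xi>. tagged_partition01 N t \<xi> \<Longrightarrow>
        \<forall>i\<in>{1..N}. t i - t (i - 1) < d2 \<Longrightarrow> hausdorff (rm_sum g N t \<xi>) J < e / 2"
      using J half_gt_zero[OF e] unfolding has_rm_integral_def by metis
    obtain n where n: "\<And>i. i \<in> {1..Suc n} \<Longrightarrow>
        real i / real (Suc n) - real (i - 1) / real (Suc n) < min d1 d2"
      using rm_sum_uniform_mesh[of "min d1 d2"] d1(1) d2(1) by (metis min_less_iff_conj order_refl)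
    define S where "S = rm_sum g (Suc n) (\<lambda>i. real i / real (Suc n)) (\<lambda>i. real i / real (Suc n))"
    have S: "S \<in> compacts"
      unfolding S_def by (rule rm_sum_compacts[OF g tagged_partition01_uniform])
    have "hausdorff S I < e / 2"
      unfolding S_def using n by (intro d1(2) tagged_partition01_uniform) (auto simp only: min_less_iff_conj)
    moreover have "hausdorff S J < e / 2"
      unfolding S_def using n by (intro d2(2) tagged_partition01_uniform) (auto simp only: min_less_iff_conj)
    ultimately show ?thesis
      using hausdorff_triangle[OF IJ(1) S IJ(2)] by (simp add: hausdorff_commute[of I S])
  qed
  then have "hausdorff I J \<le> 0" by (rule field_le_epsilon)
  with IJ show ?thesis by (rule hausdorff_eq_0_imp_eq)
qed

text \<open>A continuous set-valued function is integrable. Its integral is the convex set whose support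
  function is the integral of the support functions of the values.\<close>

theorem rm_integral_continuous:
  fixes g :: "real \<Rightarrow> 'a::euclidean_space set"
  assumes g: "set_continuous g"
  shows has_rm_integral_rm_integral: "has_rm_integral g (rm_integral g)"
    and convex_rm_integral: "convex (rm_integral g)"
    and supp_rm_integral: "supp (rm_integral g) u = integral {0..1} (\<lambda>x. supp (g x) u)"
proof -
  define H where "H u = integral {0..1} (\<lambda>x. supp (g x) u)" for u
  define S where "S n = rm_sum g (Suc n) (\<lambda>i. real i / real (Suc n)) (\<lambda>i. real i / real (Suc n))" for n
  have S: "S n \<in> compacts" for n
    unfolding S_def by (rule rm_sum_compacts[OF g tagged_partition01_uniform])
  have S_fine: "\<exists>n0. \<forall>n\<ge>n0. hausdorff (S n) (convex hull (S n)) \<le> e \<and>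
      (\<forall>u. \<bar>supp (S n) u - H u\<bar> \<le> norm u * e)" if e: "e > 0" for e
  proof -
    obtain d where d: "d > 0"
      "\<And>N t \<xi>. tagged_partition01 N t \<xi> \<Longrightarrow> \<forall>i\<in>{1..N}. t i - t (i - 1) < d \<Longrightarrow>
         hausdorff (rm_sum g N t \<xi>) (convex hull (rm_sum g N t \<xi>)) \<le> e"
      "\<And>N t \<xi> u. tagged_partition01 N t \<xi> \<Longrightarrow> \<forall>i\<in>{1..N}. t i - t (i - 1) < d \<Longrightarrow>
         \<bar>supp (rm_sum g N t \<xi>) u - integral {0..1} (\<lambda>x. supp (g x) u)\<bar> \<le> norm u * e"
      using rm_sum_fine[OF g e] by blast
    obtain n0 where n0: "\<And>n i. n \<ge> n0 \<Longrightarrow> i \<in> {1..Suc n} \<Longrightarrow>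
        real i / real (Suc n) - real (i - 1) / real (Suc n) < d"
      using rm_sum_uniform_mesh[OF d(1)] by blast
    have "hausdorff (S n) (convex hull (S n)) \<le> e \<and> (\<forall>u. \<bar>supp (S n) u - H u\<bar> \<le> norm u * e)"
      if "n \<ge> n0" for n
      unfolding S_def H_def
      using d(2,3)[OF tagged_partition01_uniform] n0[OF that] by blast
    then show ?thesis by blast
  qed
  have "\<exists>N. \<forall>m\<ge>N. \<forall>n\<ge>N. hausdorff (S m) (S n) \<le> e" if e: "e > 0" for e
  proof -
    obtain n0 where n0: "\<And>n. n \<ge> n0 \<Longrightarrow> hausdorff (S n) (convex hull (S n)) \<le> e / 4"
      "\<And>n u. n \<ge> n0 \<Longrightarrow> \<bar>supp (S n) u - H u\<bar> \<le> norm u * (e / 4)"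
      using S_fine[of "e / 4"] e by auto
    have "hausdorff (S m) (S n) \<le> e" if mn: "m \<ge> n0" "n \<ge> n0" for m n
    proof -
      have "hausdorff (convex hull (S m)) (convex hull (S n)) \<le> e / 2"
      proof (rule hausdorff_le_supp)
        fix u :: 'a assume "norm u \<le> 1"
        then have "norm u * (e / 4) \<le> e / 4" using e by (simp add: mult_left_le_one_le)
        then show "\<bar>supp (convex hull (S m)) u - supp (convex hull (S n)) u\<bar> \<le> e / 2"
          using n0(2)[OF mn(1), of u] n0(2)[OF mn(2), of u]
          unfolding supp_convex_hull[OF S] by linarith
      qed (simp_all add: S compacts_convex_hull)
      moreover have "hausdorff (S m) (S n) \<le> hausdorff (S m) (convex hull (S m)) +
          (hausdorff (convex hull (S m)) (convex hull (S n)) + hausdorff (convex hull (S n)) (S n))"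
        using hausdorff_triangle[of "S m" "convex hull (S m)" "S n"]
          hausdorff_triangle[of "convex hull (S m)" "convex hull (S n)" "S n"]
        by (simp add: S compacts_convex_hull)
      ultimately show ?thesis
        using n0(1)[OF mn(1)] n0(1)[OF mn(2)]
        by (simp add: hausdorff_commute[of "convex hull (S n)" "S n"])
    qed
    then show ?thesis by blast
  qed
  then obtain I where I: "I \<in> compacts" and lim: "(\<lambda>n. hausdorff (S n) I) \<longlonglongrightarrow> 0"
    using hausdorff_complete[of S] S by blast
  have close: "\<exists>n. hausdorff (S n) I \<le> e \<and> hausdorff (S n) (convex hull (S n)) \<le> e \<and>
      (\<forall>u. \<bar>supp (S n) u - H u\<bar> \<le> norm u * e)" if e: "e > 0" for e
  proof -
    obtain n0 where "\<forall>n\<ge>n0. hausdorff (S n) (convex hull (S n)) \<le> e \<and>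
        (\<forall>u. \<bar>supp (S n) u - H u\<bar> \<le> norm u * e)"
      using S_fine[OF e] by blast
    moreover obtain n1 where "\<forall>n\<ge>n1. hausdorff (S n) I < e"
      using order_tendstoD(2)[OF lim e] by (auto simp: eventually_sequentially)
    ultimately show ?thesis by (intro exI[of _ "max n0 n1"]) (simp add: less_imp_le)
  qed
  \<comment> \<open>The limit is convex because the distances of the sums from their convex hulls tend to \<open>0\<close>.\<close>
  have "hausdorff I (convex hull I) \<le> 0 + e" if e: "e > 0" for e
  proof -
    obtain n where n: "hausdorff (S n) I \<le> e / 3" "hausdorff (S n) (convex hull (S n)) \<le> e / 3"
      using close[of "e / 3"] e by auto
    have "hausdorff I (convex hull I) \<le> hausdorff I (S n) +
        (hausdorff (S n) (convex hull (S n)) + hausdorff (convex hull (S n)) (convex hull I))"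
      using hausdorff_triangle[of I "S n" "convex hull I"]
        hausdorff_triangle[of "S n" "convex hull (S n)" "convex hull I"]
      by (simp add: S I compacts_convex_hull)
    then show ?thesis
      using n hausdorff_convex_hull_le[OF S I, of n] by (simp add: hausdorff_commute[of I "S n"])
  qed
  then have "hausdorff I (convex hull I) \<le> 0" by (rule field_le_epsilon)
  then have "I = convex hull I"
    using I by (intro hausdorff_eq_0_imp_eq compacts_convex_hull) auto
  then have convex: "convex I" by (metis convex_convex_hull)
  have supp: "supp I u = H u" for u
  proof -
    have "\<bar>supp I u - H u\<bar> \<le> 0 + e" if e: "e > 0" for e
    proof -
      have pos: "2 * (norm u + 1) > 0" by (simp add: add_nonneg_pos)
      obtain n where n: "hausdorff (S n) I \<le> e / (2 * (norm u + 1))"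
        "\<bar>supp (S n) u - H u\<bar> \<le> norm u * (e / (2 * (norm u + 1)))"
        using close[of "e / (2 * (norm u + 1))"] e pos by auto
      have "\<bar>supp (S n) u - supp I u\<bar> \<le> norm u * (e / (2 * (norm u + 1)))"
        using supp_diff_le_hausdorff[OF S I, of n u] mult_left_mono[OF n(1), of "norm u"] by simp
      moreover have "2 * (norm u * (e / (2 * (norm u + 1)))) \<le> e"
        using e pos by (simp add: field_simps)
      ultimately show ?thesis using n(2) by linarith
    qed
    then have "\<bar>supp I u - H u\<bar> \<le> 0" by (rule field_le_epsilon)
    then show ?thesis by simp
  qed
  have "has_rm_integral g I"
    unfolding has_rm_integral_def
  proof (intro conjI I allI impI)
    fix e :: real assume e: "e > 0"
    obtain d where d: "d > 0"
      "\<And>N t \<xi>. tagged_partition01 N t \<xi> \<Longrightarrow> \<forall>i\<in>{1..N}. t i - t (i - 1) < d \<Longrightarrow>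
         hausdorff (rm_sum g N t \<xi>) (convex hull (rm_sum g N t \<xi>)) \<le> e / 3"
      "\<And>N t \<xi> u. tagged_partition01 N t \<xi> \<Longrightarrow> \<forall>i\<in>{1..N}. t i - t (i - 1) < d \<Longrightarrow>
         \<bar>supp (rm_sum g N t \<xi>) u - integral {0..1} (\<lambda>x. supp (g x) u)\<bar> \<le> norm u * (e / 3)"
      using rm_sum_fine[OF g, of "e / 3"] e by auto
    have "hausdorff (rm_sum g N t \<xi>) I < e"
      if tp: "tagged_partition01 N t \<xi>" and mesh: "\<forall>i\<in>{1..N}. t i - t (i - 1) < d" for N t \<xi>
    proof -
      let ?R = "rm_sum g N t \<xi>"
      have R: "?R \<in> compacts" using g tp by (rule rm_sum_compacts)
      have "hausdorff (convex hull ?R) I \<le> e / 3"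
      proof (rule hausdorff_le_supp)
        fix u :: 'a assume "norm u \<le> 1"
        then have "norm u * (e / 3) \<le> e / 3" using e by (simp add: mult_left_le_one_le)
        then show "\<bar>supp (convex hull ?R) u - supp I u\<bar> \<le> e / 3"
          using d(3)[OF tp mesh, of u] by (simp add: supp_convex_hull R supp H_def)
      qed (simp_all add: R I convex compacts_convex_hull)
      then show ?thesis
        using hausdorff_triangle[OF R compacts_convex_hull[OF R] I] d(2)[OF tp mesh] e by linarith
    qed
    with d(1) show "\<exists>d>0. \<forall>N t \<xi>. tagged_partition01 N t \<xi> \<and> (\<forall>i\<in>{1..N}. t i - t (i - 1) < d) \<longrightarrow>
        hausdorff (rm_sum g N t \<xi>) I < e" by blast
  qed
  moreover from this have "rm_integral g = I"
    unfolding rm_integral_def using has_rm_integral_unique[OF g] by (intro the_equality) auto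
  ultimately show "has_rm_integral g (rm_integral g)" "convex (rm_integral g)"
    "supp (rm_integral g) u = integral {0..1} (\<lambda>x. supp (g x) u)"
    using convex supp by (simp_all add: H_def)
qed

lemma set_continuous_mscale:
  fixes f :: "real \<Rightarrow> 'a::euclidean_space set"
  assumes f: "set_continuous f" and P: "continuous_on {0..1} P"
  shows "set_continuous (\<lambda>x. mscale (P x) (f x))"
proof -
  obtain M where M: "M \<ge> 0" "\<And>x a. x \<in> {0..1} \<Longrightarrow> a \<in> f x \<Longrightarrow> norm a \<le> M"
    using set_continuous_bounded[OF f] by blast
  have "bounded (P ` {0..1})" using P by (intro compact_imp_bounded compact_continuous_image) auto
  then obtain B where B: "\<forall>x\<in>{0..1}. \<bar>P x\<bar> \<le> B" by (auto simp: bounded_iff)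
  have B0: "B \<ge> 0" using B by force
  have unif: "uniformly_continuous_on {0..1} P"
    using P by (intro compact_uniformly_continuous) auto
  have "\<exists>d>0. \<forall>x\<in>{0..1}. \<forall>y\<in>{0..1}. \<bar>x - y\<bar> < d \<longrightarrow>
      hausdorff (mscale (P x) (f x)) (mscale (P y) (f y)) \<le> e" if e: "e > 0" for e
  proof -
    define e' where "e' = e / (B + M + 1)"
    have e': "e' > 0" using e B0 M(1) by (simp add: e'_def)
    obtain d1 where d1: "d1 > 0"
      "\<forall>x\<in>{0..1}. \<forall>y\<in>{0..1}. \<bar>x - y\<bar> < d1 \<longrightarrow> hausdorff (f x) (f y) \<le> e'"
      using f e' unfolding set_continuous_def by blast
    obtain d2 where d2: "d2 > 0"
      "\<forall>x\<in>{0..1}. \<forall>y\<in>{0..1}. dist y x < d2 \<longrightarrow> dist (P y) (P x) < e'"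
      using unif e' unfolding uniformly_continuous_on_def by blast
    have "hausdorff (mscale (P x) (f x)) (mscale (P y) (f y)) \<le> e"
      if x: "x \<in> {0..1}" and y: "y \<in> {0..1}" and xy: "\<bar>x - y\<bar> < min d1 d2" for x y
    proof -
      have fxy: "f x \<in> compacts" "f y \<in> compacts"
        using set_continuous_compacts[OF f] x y by blast+
      have "hausdorff (mscale (P x) (f x)) (mscale (P x) (f y)) \<le> \<bar>P x\<bar> * hausdorff (f x) (f y)"
        using fxy by (rule hausdorff_mscale)
      also have "\<dots> \<le> B * e'"
        using B B0 d1(2) x y xy hausdorff_nonneg[OF fxy] by (intro mult_mono) auto
      finally have 1: "hausdorff (mscale (P x) (f x)) (mscale (P x) (f y)) \<le> B * e'" .
      have "hausdorff (mscale (P x) (f y)) (mscale (P y) (f y)) \<le> \<bar>P x - P y\<bar> * M"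
        using fxy(2) M(2)[OF y] by (rule hausdorff_mscale_same)
      also have "\<bar>P x - P y\<bar> \<le> e'"
        using d2(2) x y xy by (auto simp: dist_real_def less_imp_le)
      then have "\<bar>P x - P y\<bar> * M \<le> e' * M" using M(1) by (rule mult_right_mono)
      finally have 2: "hausdorff (mscale (P x) (f y)) (mscale (P y) (f y)) \<le> e' * M" .
      have "B * e' + e' * M \<le> (B + M + 1) * e'" using e' by (simp add: algebra_simps)
      also have "\<dots> = e" using B0 M(1) by (simp add: e'_def)
      finally show ?thesis
        using 1 2 hausdorff_triangle[of "mscale (P x) (f x)" "mscale (P x) (f y)" "mscale (P y) (f y)"]
        by (simp add: fxy compacts_mscale)
    qed
    then show ?thesis using d1(1) d2(1) by (intro exI[of _ "min d1 d2"]) auto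
  qed
  then show ?thesis
    using set_continuous_compacts[OF f] by (simp add: set_continuous_def compacts_mscale)
qed

lemma continuous_AE_nonneg:
  fixes P :: "real \<Rightarrow> real"
  assumes cont: "continuous_on {0..1} P" and AE: "AE x in lebesgue_on {0..1}. 0 \<le> P x"
    and x: "x \<in> {0..1}"
  shows "0 \<le> P x"
proof (rule ccontr)
  assume "\<not> 0 \<le> P x"
  then obtain d where d: "d > 0" "\<forall>y\<in>{0..1}. dist y x < d \<longrightarrow> dist (P y) (P x) < - P x"
    using cont x unfolding continuous_on_iff by (metis neg_0_less_iff_less not_le)
  define a b where "a = max 0 (x - d / 2)" and "b = min 1 (x + d / 2)"
  \<comment> \<open>By continuity, \<open>P\<close> is negative on the nondegenerate interval \<open>[a,b]\<close>.\<close>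
  have neg: "y \<in> {0..1} \<and> \<not> 0 \<le> P y" if "y \<in> {a..b}" for y
  proof -
    have y: "y \<in> {0..1}" "\<bar>y - x\<bar> < d"
      using that d(1) by (auto simp: a_def b_def abs_less_iff)
    then have "\<bar>P y - P x\<bar> < - P x" using d(2) by (simp add: dist_real_def)
    with y(1) show ?thesis by linarith
  qed
  have "AE y in lebesgue. y \<in> {0..1} \<longrightarrow> 0 \<le> P y"
    using AE by (subst (asm) AE_restrict_space_iff) auto
  then obtain N where N: "N \<in> null_sets lebesgue" "{y \<in> space lebesgue. \<not> (y \<in> {0..1} \<longrightarrow> 0 \<le> P y)} \<subseteq> N"
    unfolding eventually_ae_filter by blast
  have "cbox a b \<subseteq> N" using N(2) neg by (auto simp: cbox_interval)
  then have "negligible (cbox a b)"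
    using N(1) negligible_iff_null_sets negligible_subset by blast
  moreover have "a < b" using d(1) x by (auto simp: a_def b_def)
  ultimately show False unfolding negligible_interval by (simp add: box_eq_empty)
qed

section \<open>Recovery from inexact information\<close>

text \<open>The data of the recovery problem. The function \<open>P\<close> is nonnegative at every point, which for a
  continuous function follows from nonnegativity almost everywhere (\<open>continuous_AE_nonneg\<close>).\<close>

locale recovery =
  fixes n :: nat and P \<omega> :: "real \<Rightarrow> real" and xs \<epsilon> :: "nat \<Rightarrow> real"
  assumes n: "n \<ge> 1"
    and P_cont: "continuous_on {0..1} P"
    and P_nonneg: "\<And>x. x \<in> {0..1} \<Longrightarrow> 0 \<le> P x"
    and modulus: "modulus_of_continuity \<omega>"
    and xs: "\<And>k. k \<in> {1..n} \<Longrightarrow> xs k \<in> {0..1}"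
    and eps: "\<And>k. k \<in> {1..n} \<Longrightarrow> 0 \<le> \<epsilon> k"
begin

abbreviation "fm \<equiv> f_min n \<omega> xs \<epsilon>"
abbreviation "Pis \<equiv> Pi_set n \<omega> xs \<epsilon>"

lemma omega_nonneg: "t \<ge> 0 \<Longrightarrow> 0 \<le> \<omega> t"
  using modulus by (simp add: modulus_of_continuity_def)

lemma omega_triangle: "\<omega> \<bar>x - z\<bar> \<le> \<omega> \<bar>y - z\<bar> + \<omega> \<bar>x - y\<bar>"
proof -
  have "\<omega> \<bar>x - z\<bar> \<le> \<omega> (\<bar>y - z\<bar> + \<bar>x - y\<bar>)"
    using modulus unfolding modulus_of_continuity_def by (auto elim!: mono_onD)
  also have "\<dots> \<le> \<omega> \<bar>y - z\<bar> + \<omega> \<bar>x - y\<bar>"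
    using modulus unfolding modulus_of_continuity_def by auto
  finally show ?thesis .
qed

lemma omega_small:
  assumes "e > 0"
  obtains d where "d > 0" "\<And>t. 0 \<le> t \<Longrightarrow> t < d \<Longrightarrow> \<omega> t < e"
proof -
  have "continuous_on {0..} \<omega>" "\<omega> 0 = 0" using modulus by (auto simp: modulus_of_continuity_def)
  then obtain d where d: "d > 0" "\<forall>t\<in>{0..}. dist t 0 < d \<longrightarrow> dist (\<omega> t) (\<omega> 0) < e"
    using assms unfolding continuous_on_iff by (metis atLeast_iff order_refl)
  show ?thesis
    by (rule that[OF d(1)]) (use d(2) \<open>\<omega> 0 = 0\<close> in \<open>force simp: dist_real_def\<close>)
qed

lemma omega_continuous_on:
  fixes \<phi> :: "real \<Rightarrow> real"
  assumes "\<And>x y. \<bar>\<phi> x - \<phi> y\<bar> \<le> \<omega> \<bar>x - y\<bar>"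
  shows "continuous_on S \<phi>"
  unfolding continuous_on_iff
proof (intro ballI allI impI)
  fix x and e :: real assume "e > 0"
  then obtain d where d: "d > 0" "\<And>t. 0 \<le> t \<Longrightarrow> t < d \<Longrightarrow> \<omega> t < e" using omega_small by blast
  have "dist (\<phi> y) (\<phi> x) < e" if "dist y x < d" for y
    using assms[of y x] d(2)[of "\<bar>y - x\<bar>"] that by (simp add: dist_real_def)
  with d(1) show "\<exists>d>0. \<forall>y\<in>S. dist y x < d \<longrightarrow> dist (\<phi> y) (\<phi> x) < e" by blast
qed

lemma H_class_set_continuous:
  assumes "f \<in> H_class \<omega>"
  shows "set_continuous f"
  unfolding set_continuous_def
proof (intro conjI allI impI)
  show "\<forall>x\<in>{0..1}. f x \<in> compacts" using assms by (simp add: H_class_def)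
  fix e :: real assume "e > 0"
  then obtain d where d: "d > 0" "\<And>t. 0 \<le> t \<Longrightarrow> t < d \<Longrightarrow> \<omega> t < e" using omega_small by blast
  have "hausdorff (f x) (f y) \<le> e" if "x \<in> {0..1}" "y \<in> {0..1}" "\<bar>x - y\<bar> < d" for x y
  proof -
    have "hausdorff (f x) (f y) \<le> \<omega> \<bar>x - y\<bar>" using assms that by (simp add: H_class_def)
    also have "\<dots> < e" using that by (intro d(2)) auto
    finally show ?thesis by simp
  qed
  with d(1) show "\<exists>d>0. \<forall>x\<in>{0..1}. \<forall>y\<in>{0..1}. \<bar>x - y\<bar> < d \<longrightarrow> hausdorff (f x) (f y) \<le> e"
    by blast
qed

lemma f_min_le: "k \<in> {1..n} \<Longrightarrow> fm x \<le> \<epsilon> k + \<omega> \<bar>x - xs k\<bar>"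
  unfolding f_min_def by (intro Min_le) auto

lemma f_min_attained:
  obtains k where "k \<in> {1..n}" "fm x = \<epsilon> k + \<omega> \<bar>x - xs k\<bar>"
proof -
  have "fm x \<in> (\<lambda>k. \<epsilon> k + \<omega> \<bar>x - xs k\<bar>) ` {1..n}"
    unfolding f_min_def using n by (intro Min_in) auto
  then show ?thesis using that by blast
qed

lemma f_min_nonneg: "0 \<le> fm x"
proof -
  obtain k where "k \<in> {1..n}" "fm x = \<epsilon> k + \<omega> \<bar>x - xs k\<bar>" by (rule f_min_attained)
  then show ?thesis using eps omega_nonneg[of "\<bar>x - xs k\<bar>"] by simp
qed

lemma f_min_modulus: "\<bar>fm x - fm y\<bar> \<le> \<omega> \<bar>x - y\<bar>"
proof -
  have *: "fm x \<le> fm y + \<omega> \<bar>x - y\<bar>" for x y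
  proof -
    obtain k where "k \<in> {1..n}" "fm y = \<epsilon> k + \<omega> \<bar>y - xs k\<bar>" by (rule f_min_attained)
    then show ?thesis using f_min_le[of k x] omega_triangle[of x "xs k" y] by linarith
  qed
  show ?thesis using *[of x y] *[of y x] by (simp add: abs_minus_commute abs_le_iff)
qed

lemma P_f_min_integrable: "(\<lambda>x. P x * fm x) integrable_on {0..1}"
  by (intro integrable_continuous_real continuous_intros P_cont omega_continuous_on f_min_modulus)

lemma Pi_set_measurable: "Pis k \<in> sets lebesgue"
proof -
  have "\<bar>(\<epsilon> k + \<omega> \<bar>x - xs k\<bar>) - (\<epsilon> k + \<omega> \<bar>y - xs k\<bar>)\<bar> \<le> \<omega> \<bar>x - y\<bar>" for x y
    using omega_triangle[of x "xs k" y] omega_triangle[of y "xs k" x]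
    by (simp add: abs_minus_commute[of y x] abs_le_iff)
  then have "continuous_on UNIV (\<lambda>x. \<epsilon> k + \<omega> \<bar>x - xs k\<bar>)"
    by (rule omega_continuous_on)
  then have "closed {x. fm x = \<epsilon> k + \<omega> \<bar>x - xs k\<bar>}"
    by (rule closed_Collect_eq[OF omega_continuous_on[OF f_min_modulus]])
  moreover have "Pis k = {0..1} \<inter> {x. fm x = \<epsilon> k + \<omega> \<bar>x - xs k\<bar>}" by (auto simp: Pi_set_def)
  ultimately have "closed (Pis k)" by auto
  then show ?thesis by (simp add: borel_closed)
qed

lemma integral_P_subset:
  assumes "S \<in> sets lebesgue" "S \<subseteq> {0..1}"
  shows "(\<lambda>x. if x \<in> S then P x else 0) integrable_on {0..1}"
    and "integral {0..1} (\<lambda>x. if x \<in> S then P x else 0) = integral S P"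
proof -
  have "P absolutely_integrable_on {0..1}" by (rule absolutely_integrable_continuous_real[OF P_cont])
  then have "P absolutely_integrable_on S" using assms by (rule set_integrable_subset)
  then have "P integrable_on S" by (rule set_lebesgue_integral_eq_integral(1))
  moreover have "S \<inter> {0..1} = S" using assms(2) by auto
  ultimately show "(\<lambda>x. if x \<in> S then P x else 0) integrable_on {0..1}"
    and "integral {0..1} (\<lambda>x. if x \<in> S then P x else 0) = integral S P"
    by (simp_all add: Henstock_Kurzweil_Integration.integral_restrict_Int integrable_restrict_Int)
qed

text \<open>The sets \<open>Pis k\<close> cover \<open>[0,1]\<close> but may overlap. A partition is obtained by assigning each point
  to the least admissible index.\<close>

definition cell :: "nat \<Rightarrow> real set" where
  "cell k = Pis k - (\<Union>j\<in>{1..<k}. Pis j)"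

text \<open>The mass of a cell with respect to the density \<open>P\<close>.\<close>

definition weight :: "nat \<Rightarrow> real" where
  "weight k = integral (cell k) P"

text \<open>The counterpart of \<^const>\<open>Phi_star\<close> with the weights of this partition.\<close>

definition cell_method :: "(nat \<Rightarrow> 'a::euclidean_space set) \<Rightarrow> 'a set" where
  "cell_method A = convex hull (\<Sum>k=1..n. mscale (weight k) (A k))"

lemma cell_subset: "cell k \<subseteq> Pis k" "cell k \<subseteq> {0..1}"
  by (auto simp: cell_def Pi_set_def)

lemma cell_measurable: "cell k \<in> sets lebesgue"
  unfolding cell_def by (intro sets.Diff sets.finite_UN Pi_set_measurable) auto

lemma cell_unique:
  assumes x: "x \<in> {0..1}"
  obtains k where "k \<in> {1..n}" "\<And>j. j \<in> {1..n} \<Longrightarrow> x \<in> cell j \<longleftrightarrow> j = k"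
proof -
  define k where "k = (LEAST k. k \<in> {1..n} \<and> x \<in> Pis k)"
  obtain i where "i \<in> {1..n} \<and> x \<in> Pis i"
    using f_min_attained[of x] x by (auto simp: Pi_set_def)
  then have k: "k \<in> {1..n} \<and> x \<in> Pis k" unfolding k_def by (rule LeastI)
  have least: "k \<le> j" if "j \<in> {1..n}" "x \<in> Pis j" for j
    unfolding k_def using that by (intro Least_le) auto
  have "x \<in> cell j \<longleftrightarrow> j = k" if j: "j \<in> {1..n}" for j
  proof
    assume "x \<in> cell j"
    then have "x \<in> Pis j" "\<not> k < j" using k by (auto simp: cell_def)
    then show "j = k" using least[OF j] by simp
  next
    assume "j = k"
    moreover have "x \<notin> Pis i" if "i \<in> {1..<k}" for i
      using least[of i] that k by auto
    ultimately show "x \<in> cell j" using k by (auto simp: cell_def)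
  qed
  with k show ?thesis using that by blast
qed

lemma weight_nonneg: "0 \<le> weight k"
proof -
  have "0 \<le> integral {0..1} (\<lambda>x. if x \<in> cell k then P x else 0)"
    using P_nonneg by (intro Henstock_Kurzweil_Integration.integral_nonneg integral_P_subset cell_measurable cell_subset) auto
  then show ?thesis by (simp add: weight_def integral_P_subset cell_measurable cell_subset)
qed

lemma compacts_weighted_sum:
  assumes "\<And>k. k \<in> {1..n} \<Longrightarrow> A k \<in> compacts"
  shows "(\<Sum>k=1..n. mscale (w k) (A k)) \<in> compacts"
  using assms by (intro compacts_sum compacts_mscale)

lemma cell_method_methods: "cell_method \<in> methods n"
  unfolding methods_def cell_method_def
  by (intro Pi_I compacts_convex_hull compacts_weighted_sum) (rule PiE_mem)

lemma admissible_infoD: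
  assumes "A \<in> admissible_info n xs \<epsilon> f" "k \<in> {1..n}"
  shows "A k \<in> compacts" "hausdorff (A k) (f (xs k)) \<le> \<epsilon> k"
  using assms by (auto simp: admissible_info_def)

text \<open>The support functions of the integral and of the recovered set are integrals over \<open>[0,1]\<close> whose
  integrands differ by at most \<open>P x * fm x\<close>: on the cell of index \<open>k\<close> the set \<open>A k\<close> replaces
  \<open>f x\<close>.\<close>

lemma cell_method_error_le:
  fixes f :: "real \<Rightarrow> 'a::euclidean_space set"
  assumes f: "f \<in> H_class \<omega>" and A: "A \<in> admissible_info n xs \<epsilon> f"
  shows "hausdorff (rm_integral (\<lambda>x. mscale (P x) (f x))) (cell_method A)
    \<le> integral {0..1} (\<lambda>x. P x * fm x)"
proof (rule hausdorff_le_supp)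
  have g: "set_continuous (\<lambda>x. mscale (P x) (f x))"
    by (intro set_continuous_mscale H_class_set_continuous f P_cont)
  show "rm_integral (\<lambda>x. mscale (P x) (f x)) \<in> compacts"
    using has_rm_integral_rm_integral[OF g] by (simp add: has_rm_integral_def)
  show "convex (rm_integral (\<lambda>x. mscale (P x) (f x)))" by (rule convex_rm_integral[OF g])
  have sum: "(\<Sum>k=1..n. mscale (weight k) (A k)) \<in> compacts"
    using admissible_infoD(1)[OF A] by (rule compacts_weighted_sum)
  show "cell_method A \<in> compacts" "convex (cell_method A)"
    unfolding cell_method_def using compacts_convex_hull[OF sum] convex_convex_hull by blast+
  fix u :: 'a assume u: "norm u \<le> 1"
  define F where "F x = supp (mscale (P x) (f x)) u" for x
  define G where "G x = (\<Sum>k=1..n. (if x \<in> cell k then P x else 0) * supp (A k) u)" for x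
  have F: "F integrable_on {0..1}"
    unfolding F_def by (intro integrable_continuous_real continuous_on_supp g)
  have cell_int: "(\<lambda>x. (if x \<in> cell k then P x else 0) * supp (A k) u) integrable_on {0..1}" for k
    by (intro integrable_on_mult_left integral_P_subset cell_measurable cell_subset)
  then have G: "G integrable_on {0..1}" unfolding G_def by (intro integrable_sum) auto
  have "integral {0..1} G = (\<Sum>k=1..n. weight k * supp (A k) u)"
    unfolding G_def using cell_int
    by (simp add: integral_sum integral_P_subset cell_measurable cell_subset weight_def)
  also have "\<dots> = supp (cell_method A) u"
    unfolding cell_method_def supp_convex_hull[OF sum]
    using admissible_infoD(1)[OF A]
    by (subst supp_sum) (auto simp: supp_mscale compacts_mscale weight_nonneg)
  finally have "integral {0..1} G = supp (cell_method A) u" .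
  moreover have "integral {0..1} F = supp (rm_integral (\<lambda>x. mscale (P x) (f x))) u"
    unfolding F_def by (rule supp_rm_integral[OF g, symmetric])
  ultimately have "supp (rm_integral (\<lambda>x. mscale (P x) (f x))) u - supp (cell_method A) u
      = integral {0..1} (\<lambda>x. F x - G x)"
    using F G by (simp add: integral_diff)
  moreover have "norm (integral {0..1} (\<lambda>x. F x - G x)) \<le> integral {0..1} (\<lambda>x. P x * fm x)"
  proof (rule integral_norm_bound_integral)
    fix x :: real assume x: "x \<in> {0..1}"
    obtain k where k: "k \<in> {1..n}" and cell: "\<And>j. j \<in> {1..n} \<Longrightarrow> x \<in> cell j \<longleftrightarrow> j = k"
      using cell_unique[OF x] by blast
    have "G x = (\<Sum>j=1..n. if j = k then P x * supp (A k) u else 0)"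
      unfolding G_def using cell by (intro sum.cong) auto
    also have "\<dots> = P x * supp (A k) u" using k by simp
    finally have G: "G x = P x * supp (A k) u" .
    have fx: "f x \<in> compacts" and fk: "f (xs k) \<in> compacts" and Ak: "A k \<in> compacts"
      using f x xs[OF k] admissible_infoD(1)[OF A k] by (auto simp: H_class_def)
    have "\<bar>supp (f x) u - supp (A k) u\<bar> \<le> norm u * hausdorff (f x) (A k)"
      by (rule supp_diff_le_hausdorff[OF fx Ak])
    also have "\<dots> \<le> hausdorff (f x) (A k)"
      using u hausdorff_nonneg[OF fx Ak] by (simp add: mult_left_le_one_le)
    also have "\<dots> \<le> hausdorff (f x) (f (xs k)) + hausdorff (f (xs k)) (A k)"
      by (rule hausdorff_triangle[OF fx fk Ak])
    also have "\<dots> \<le> \<omega> \<bar>x - xs k\<bar> + \<epsilon> k"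
      using f x xs[OF k] admissible_infoD(2)[OF A k]
      by (intro add_mono) (auto simp: H_class_def hausdorff_commute[of "f (xs k)"])
    also have "\<dots> = fm x" using cell[OF k] cell_subset(1)[of k] by (auto simp: Pi_set_def)
    finally have "P x * \<bar>supp (f x) u - supp (A k) u\<bar> \<le> P x * fm x"
      using P_nonneg[OF x] by (intro mult_left_mono)
    then show "norm (F x - G x) \<le> P x * fm x"
      using P_nonneg[OF x]
      by (simp add: F_def G supp_mscale fx abs_mult right_diff_distrib[symmetric])
  qed (use F G P_f_min_integrable in \<open>auto intro: integrable_diff\<close>)
  ultimately show "\<bar>supp (rm_integral (\<lambda>x. mscale (P x) (f x))) u - supp (cell_method A) u\<bar>
      \<le> integral {0..1} (\<lambda>x. P x * fm x)" by simp
qed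

lemma method_error_cell_method:
  "method_error n P (H_class \<omega> :: (real \<Rightarrow> 'a::euclidean_space set) set) cell_method xs \<epsilon>
    \<le> ereal (integral {0..1} (\<lambda>x. P x * fm x))"
  unfolding method_error_def by (intro SUP_least) (simp add: cell_method_error_le)

text \<open>The lower bound for every method. No method can distinguish the two single-valued functions
  \<open>fm x *\<^sub>R e\<close> and \<open>- fm x *\<^sub>R e\<close> from the information \<open>A k = {0}\<close>, where \<open>e\<close> is a unit vector; their integrals are at a distance
  of twice the claimed bound.\<close>

lemma method_error_ge:
  fixes \<Phi> :: "(nat \<Rightarrow> 'a::euclidean_space set) \<Rightarrow> 'a set"
  assumes \<Phi>: "\<Phi> \<in> methods n"
  shows "ereal (integral {0..1} (\<lambda>x. P x * fm x)) \<le> method_error n P (H_class \<omega>) \<Phi> xs \<epsilon>"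
proof -
  define c where "c = integral {0..1} (\<lambda>x. P x * fm x)"
  obtain e :: 'a where e: "norm e = 1" using vector_choose_size[of 1] by auto
  define f where "f s x = {(s * fm x) *\<^sub>R e}" for s x
  define A where "A = (\<lambda>k\<in>{1..n}. {0::'a})"
  have A: "A \<in> {1..n} \<rightarrow>\<^sub>E compacts" by (auto simp: A_def)
  have f: "f s \<in> H_class \<omega>" if s: "\<bar>s\<bar> = 1" for s
  proof -
    have "hausdorff (f s x) (f s y) = \<bar>fm x - fm y\<bar>" for x y
      using e s by (simp add: f_def hausdorff_singletons dist_norm abs_mult
          flip: scaleR_diff_left right_diff_distrib)
    then show ?thesis using f_min_modulus by (auto simp: H_class_def f_def)
  qed
  have info: "A \<in> admissible_info n xs \<epsilon> (f s)" if s: "\<bar>s\<bar> = 1" for s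
  proof -
    have "hausdorff (A k) (f s (xs k)) \<le> \<epsilon> k" if k: "k \<in> {1..n}" for k
    proof -
      have "hausdorff (A k) (f s (xs k)) = fm (xs k)"
        using k e s f_min_nonneg by (simp add: A_def f_def hausdorff_singletons abs_mult)
      also have "\<dots> \<le> \<epsilon> k"
        using f_min_le[OF k, of "xs k"] modulus by (simp add: modulus_of_continuity_def)
      finally show ?thesis .
    qed
    with A show ?thesis by (auto simp: admissible_info_def)
  qed
  have integral: "rm_integral (\<lambda>x. mscale (P x) (f s x)) = {(s * c) *\<^sub>R e}" if s: "\<bar>s\<bar> = 1" for s
  proof -
    have g: "set_continuous (\<lambda>x. mscale (P x) (f s x))"
      by (intro set_continuous_mscale H_class_set_continuous f s P_cont)
    have comp: "rm_integral (\<lambda>x. mscale (P x) (f s x)) \<in> compacts"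
      using has_rm_integral_rm_integral[OF g] by (simp add: has_rm_integral_def)
    have "hausdorff (rm_integral (\<lambda>x. mscale (P x) (f s x))) {(s * c) *\<^sub>R e} \<le> 0"
    proof (rule hausdorff_le_supp)
      fix u :: 'a
      have "supp (rm_integral (\<lambda>x. mscale (P x) (f s x))) u
          = integral {0..1} (\<lambda>x. (P x * fm x) * (s * (u \<bullet> e)))"
        unfolding supp_rm_integral[OF g] by (simp add: f_def mscale_def mult_ac)
      also have "\<dots> = c * (s * (u \<bullet> e))" unfolding c_def by (rule integral_mult_left)
      finally show "\<bar>supp (rm_integral (\<lambda>x. mscale (P x) (f s x))) u - supp {(s * c) *\<^sub>R e} u\<bar> \<le> 0"
        by simp
    qed (simp_all add: comp convex_rm_integral[OF g])
    with comp show ?thesis by (intro hausdorff_eq_0_imp_eq) auto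
  qed
  have err: "ereal (hausdorff {(s * c) *\<^sub>R e} (\<Phi> A)) \<le> method_error n P (H_class \<omega>) \<Phi> xs \<epsilon>"
    if s: "\<bar>s\<bar> = 1" for s
    unfolding method_error_def
    by (rule SUP_upper2[OF f[OF s]], rule SUP_upper2[OF info[OF s]]) (simp add: integral[OF s])
  have \<Phi>A: "\<Phi> A \<in> compacts" using \<Phi> A by (auto simp: methods_def)
  have "2 * c \<le> dist ((1 * c) *\<^sub>R e) ((- 1 * c) *\<^sub>R e)"
    using e by (simp add: dist_norm flip: scaleR_2)
  also have "\<dots> \<le> hausdorff {(1 * c) *\<^sub>R e} (\<Phi> A) + hausdorff {(- 1 * c) *\<^sub>R e} (\<Phi> A)"
    using hausdorff_triangle[OF compacts_singleton \<Phi>A compacts_singleton]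
    unfolding hausdorff_singletons[symmetric] hausdorff_commute[of "\<Phi> A"] by blast
  finally have "c \<le> hausdorff {(1 * c) *\<^sub>R e} (\<Phi> A) \<or> c \<le> hausdorff {(- 1 * c) *\<^sub>R e} (\<Phi> A)"
    by linarith
  then show ?thesis
    unfolding c_def[symmetric] using err[of 1] err[of "- 1"]
    by (auto intro: order_trans[rotated])
qed

lemma optimal_error_eq:
  "optimal_error n P (H_class \<omega> :: (real \<Rightarrow> 'a::euclidean_space set) set) xs \<epsilon>
    = ereal (integral {0..1} (\<lambda>x. P x * fm x))"
  unfolding optimal_error_def
  by (intro antisym INF_greatest method_error_ge INF_lower2[OF cell_method_methods]
      method_error_cell_method)

text \<open>If the overlaps of the sets \<open>Pis k\<close> carry no mass, then neither does the part of
  \<open>Pis k\<close> outside \<open>cell k\<close>, because overlaps with the sets of smaller index cover it.\<close>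

lemma weight_eq_Pi:
  assumes overlap: "\<forall>i\<in>{1..n}. \<forall>j\<in>{1..n}. i \<noteq> j \<longrightarrow> integral (Pis i \<inter> Pis j) P = 0"
    and k: "k \<in> {1..n}"
  shows "integral (Pis k) P = weight k"
proof -
  define R where "R S x = (if x \<in> S then P x else 0)" for S x
  have sub: "Pis k \<subseteq> {0..1}" for k by (auto simp: Pi_set_def)
  have R: "R S integrable_on {0..1}" "integral {0..1} (R S) = integral S P"
    if "S \<in> sets lebesgue" "S \<subseteq> {0..1}" for S
    unfolding R_def using integral_P_subset[OF that] by auto
  have meas: "Pis k \<inter> Pis j \<in> sets lebesgue" "Pis k \<inter> Pis j \<subseteq> {0..1}" for j
    using Pi_set_measurable sub by (auto intro: sets.Int)
  note Pik = R[OF Pi_set_measurable sub, of k]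
  note cellk = R[OF cell_measurable cell_subset(2), of k]
  have "integral {0..1} (R (Pis k)) \<le> integral {0..1} (\<lambda>x. R (cell k) x + (\<Sum>j\<in>{1..<k}. R (Pis k \<inter> Pis j) x))"
  proof (rule integral_le)
    show "(\<lambda>x. R (cell k) x + (\<Sum>j\<in>{1..<k}. R (Pis k \<inter> Pis j) x)) integrable_on {0..1}"
      by (intro integrable_add integrable_sum cellk R meas) auto
    fix x :: real assume x: "x \<in> {0..1}"
    have nonneg: "0 \<le> R S x" for S using P_nonneg[OF x] by (simp add: R_def)
    show "R (Pis k) x \<le> R (cell k) x + (\<Sum>j\<in>{1..<k}. R (Pis k \<inter> Pis j) x)"
    proof (cases "x \<in> Pis k \<and> x \<notin> cell k")
      case True
      then obtain j where j: "j \<in> {1..<k}" "x \<in> Pis k \<inter> Pis j" by (auto simp: cell_def)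
      then have "R (Pis k) x = R (Pis k \<inter> Pis j) x" by (simp add: R_def)
      also have "\<dots> \<le> (\<Sum>j\<in>{1..<k}. R (Pis k \<inter> Pis j) x)"
        using j(1) nonneg by (intro member_le_sum) auto
      finally show ?thesis using nonneg[of "cell k"] by linarith
    next
      case False
      then have "R (Pis k) x = R (cell k) x" using cell_subset(1)[of k] by (auto simp: R_def)
      then show ?thesis using nonneg by (simp add: sum_nonneg)
    qed
  qed (rule Pik)
  also have "\<dots> = integral {0..1} (R (cell k)) + (\<Sum>j\<in>{1..<k}. integral {0..1} (R (Pis k \<inter> Pis j)))"
    using R(1)[OF meas] cellk(1)
    by (subst integral_add) (auto intro!: integrable_sum simp: integral_sum)
  also have "(\<Sum>j\<in>{1..<k}. integral {0..1} (R (Pis k \<inter> Pis j))) = 0"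
    using overlap k by (intro sum.neutral ballI) (auto simp: R(2)[OF meas])
  finally have "integral (Pis k) P \<le> weight k" by (simp add: Pik cellk weight_def)
  moreover have "integral {0..1} (R (cell k)) \<le> integral {0..1} (R (Pis k))"
    using cell_subset(1)[of k] P_nonneg
    by (intro integral_le Pik cellk) (auto simp: R_def)
  ultimately show ?thesis by (simp add: Pik cellk weight_def)
qed

text \<open>The indices with empty \<open>Pis k\<close>, which \<^const>\<open>Phi_star\<close> omits, have weight \<open>0\<close> and contribute
  the summand \<open>{0}\<close>.\<close>

lemma Phi_star_eq_cell_method:
  assumes overlap: "\<forall>i\<in>{1..n}. \<forall>j\<in>{1..n}. i \<noteq> j \<longrightarrow> integral (Pis i \<inter> Pis j) P = 0"
    and A: "\<And>k. k \<in> {1..n} \<Longrightarrow> A k \<in> compacts"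
  shows "Phi_star n P \<omega> xs \<epsilon> A = cell_method A"
proof -
  have "(\<Sum>k\<in>{k\<in>{1..n}. Pis k \<noteq> {}}. mscale (integral (Pis k) P) (A k))
      = (\<Sum>k\<in>{k\<in>{1..n}. Pis k \<noteq> {}}. mscale (weight k) (A k))"
    by (intro sum.cong refl) (simp add: weight_eq_Pi[OF overlap])
  also have "\<dots> = (\<Sum>k=1..n. mscale (weight k) (A k))"
  proof (rule sum.mono_neutral_left)
    show "\<forall>k\<in>{1..n} - {k\<in>{1..n}. Pis k \<noteq> {}}. mscale (weight k) (A k) = 0"
    proof
      fix k assume k: "k \<in> {1..n} - {k\<in>{1..n}. Pis k \<noteq> {}}"
      then have "weight k = 0" using cell_subset(1)[of k] by (auto simp: weight_def)
      moreover have "A k \<noteq> {}" using A k by (auto simp: compacts_def)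
      ultimately show "mscale (weight k) (A k) = 0" by (auto simp: mscale_def)
    qed
  qed auto
  finally show ?thesis by (simp add: Phi_star_def cell_method_def)
qed

lemma method_error_Phi_star:
  assumes overlap: "\<forall>i\<in>{1..n}. \<forall>j\<in>{1..n}. i \<noteq> j \<longrightarrow> integral (Pis i \<inter> Pis j) P = 0"
  shows "method_error n P (H_class \<omega> :: (real \<Rightarrow> 'a::euclidean_space set) set)
      (Phi_star n P \<omega> xs \<epsilon>) xs \<epsilon> = ereal (integral {0..1} (\<lambda>x. P x * fm x))"
proof (rule antisym)
  have "Phi_star n P \<omega> xs \<epsilon> A = cell_method A" if "A \<in> admissible_info n xs \<epsilon> f"
    for f :: "real \<Rightarrow> 'a set" and A
    using overlap admissible_infoD(1)[OF that] by (rule Phi_star_eq_cell_method)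
  then show "method_error n P (H_class \<omega> :: (real \<Rightarrow> 'a set) set) (Phi_star n P \<omega> xs \<epsilon>) xs \<epsilon>
      \<le> ereal (integral {0..1} (\<lambda>x. P x * fm x))"
    unfolding method_error_def by (intro SUP_least) (simp add: cell_method_error_le)
qed (rule method_error_ge[OF Phi_star_methods])

end

theorem theorem4:
  fixes n :: nat and P \<omega> :: "real \<Rightarrow> real" and xs \<epsilon> :: "nat \<Rightarrow> real"
  assumes "n \<ge> 1"
    and "continuous_on {0..1} P"
    and "AE x in lebesgue_on {0..1}. 0 \<le> P x"
    and "modulus_of_continuity \<omega>"
    and "strict_mono_on {0..} \<omega>"
    and "\<forall>k\<in>{1..n}. xs k \<in> {0..1}"
    and "inj_on xs {1..n}"
    and "\<forall>k\<in>{1..n}. 0 \<le> \<epsilon> k"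
  shows "optimal_error n P (H_class \<omega> :: (real \<Rightarrow> (real ^ 'm::finite) set) set) xs \<epsilon>
           = ereal (integral {0..1} (\<lambda>x. P x * f_min n \<omega> xs \<epsilon> x))
       \<and> ((\<forall>i\<in>{1..n}. \<forall>j\<in>{1..n}. i \<noteq> j \<longrightarrow>
              integral (Pi_set n \<omega> xs \<epsilon> i \<inter> Pi_set n \<omega> xs \<epsilon> j) P = 0) \<longrightarrow>
          method_error n P (H_class \<omega> :: (real \<Rightarrow> (real ^ 'm::finite) set) set)
              (Phi_star n P \<omega> xs \<epsilon>) xs \<epsilon>
            = ereal (integral {0..1} (\<lambda>x. P x * f_min n \<omega> xs \<epsilon> x)))"
proof -
  interpret recovery n P \<omega> xs \<epsilon>
    using assms continuous_AE_nonneg[OF assms(2,3)] by unfold_locales auto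
  show ?thesis using optimal_error_eq method_error_Phi_star by blast
qed

end
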